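(* Let $2\le s\le s'$ be integers. There is a constant $c=c(s,s')>0$ such that every $K_{s,s'}$-free graph $G$ with average degree $r$ contains a minor with average degree at least $c\,r^{1+\frac{1}{2(s-1)}}$.
   Context: All graphs are finite, simple. $K_{s,s'}$ is the complete bipartite graph with parts of sizes $s$ and $s'$; $G$ is $K_{s,s'}$-free if it has no subgraph isomorphic to $K_{s,s'}$. The average degree of $G$ is $2|E(G)|/|V(G)|$. A graph $\Gamma$ is a minor of $G$ if there are vertex-disjoint connected subgraphs $G_u\subseteq G$, $u\in V(\Gamma)$, with an edge of $G$ between $G_u$ and $G_{u'}$ whenever $uu'\in E(\Gamma)$. *)

theory Defs
  imports Complex_Main "Graph_Theory.Graph_Theory"
begin

text \<open>
  A finite simple graph is a \<^locale>\<open>pair_graph\<close>: a finite loop-free symmetric digraph without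
  parallel arcs, in which every undirected edge \<open>uv\<close> appears as the two arcs \<open>(u, v)\<close> and \<open>(v, u)\<close>.
\<close>

definition edges :: "'a pair_pre_digraph \<Rightarrow> 'a set set" where
  "edges G = {{u, v} | u v. (u, v) \<in> parcs G}"

definition average_degree :: "'a pair_pre_digraph \<Rightarrow> real" where
  "average_degree G = 2 * real (card (edges G)) / real (card (pverts G))"

text \<open>
  The library predicate \<open>K\<^bsub>m,n\<^esub> H\<close> says that \<open>H\<close> itself is a complete bipartite graph with parts of
  sizes \<open>m\<close> and \<open>n\<close>, so it already covers the isomorphism in ``subgraph isomorphic to''.
\<close>

definition complete_bipartite_free :: "nat \<Rightarrow> nat \<Rightarrow> 'a pair_pre_digraph \<Rightarrow> bool" where
  "complete_bipartite_free m n G \<longleftrightarrow>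
     \<not> (\<exists>H :: 'a pair_pre_digraph. subgraph (with_proj H) (with_proj G)
          \<and> complete_bipartite_digraph m n (with_proj H))"

text \<open>
  Connectedness here is the graph-theoretic one, not the topological one; it includes
  nonemptiness of the vertex set.
\<close>

definition is_minor :: "'b pair_pre_digraph \<Rightarrow> 'a pair_pre_digraph \<Rightarrow> bool" where
  "is_minor \<Gamma> G \<longleftrightarrow>
     (\<exists>B :: 'b \<Rightarrow> 'a pair_pre_digraph.
        (\<forall>u \<in> pverts \<Gamma>. pair_graph (B u) \<and> subgraph (with_proj (B u)) (with_proj G)
           \<and> Digraph_Component.connected (with_proj (B u))) \<and>
        (\<forall>u \<in> pverts \<Gamma>. \<forall>u' \<in> pverts \<Gamma>. u \<noteq> u' \<longrightarrow> pverts (B u) \<inter> pverts (B u') = {}) \<and>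
        (\<forall>(u, u') \<in> parcs \<Gamma>. \<exists>x \<in> pverts (B u). \<exists>y \<in> pverts (B u'). (x, y) \<in> parcs G))"

end

theory Submission
  imports Defs "HOL-Probability.Product_PMF" "HOL-Library.Disjoint_Sets"
begin

text \<open>
  Passing to a large cut and deleting vertices of low degree gives a bipartite subgraph with parts
  \<open>X\<close> and \<open>Y\<close>, \<open>|Y| \<le> |X|\<close>, and all degrees at least \<open>2 * d\<close>, where \<open>d\<close> is of order \<open>r\<close>. Let
  \<open>m \<approx> d powr (1 / (2 * (s - 1)))\<close> up to a constant. The minor is obtained by contracting disjoint
  stars. Pack greedily stars with centres in \<open>Y\<close> and \<open>40 * m\<close> leaves in \<open>X\<close>, and let \<open>Z\<close> be the set of
  their centres. By the double counting of Kovari, Sos and Turan, the leaves of one star have of order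
  \<open>m * d\<close> distinct neighbours.

  If many vertices of \<open>X\<close> send half of their edges to \<open>Z\<close>, then \<open>Z\<close> is much smaller than the set of
  these vertices, and contracting stars with \<open>m\<close> leaves onto a subset of \<open>Z\<close> gives average degree of
  order \<open>m * d\<close>. Otherwise there are of order \<open>|X| / m\<close> stars, most of whose edges go to \<open>Y - Z\<close>. Then
  \<open>Y - Z\<close> is itself contracted onto a random set of about \<open>|X| / (40 * m)\<close> centres in \<open>X\<close>, each vertex
  choosing a random neighbouring centre. If \<open>T\<close> is a set of neighbours of one star, the expected
  number of pairs of \<open>T\<close> that collide is governed by the sum of \<open>n e ^ 2\<close> over \<open>e\<close> in \<open>X\<close>, where
  \<open>n e\<close> is the sum of the inverse degrees of the vertices of \<open>T\<close> adjacent to \<open>e\<close>; splitting at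
  \<open>n e = 1 / (2560 * m)\<close> and double counting \<open>s\<close>-subsets of \<open>T\<close> shows that it is at most a small
  multiple of \<open>|T|\<close>, precisely because \<open>m ^ (2 * (s - 1))\<close> is at most a small multiple of \<open>d\<close>.
\<close>

subsection \<open>Random subsets and random choices\<close>

lemma exists_le_expectation:
  fixes f :: "'a \<Rightarrow> real"
  assumes "finite (set_pmf M)"
  shows "\<exists>x\<in>set_pmf M. f x \<le> measure_pmf.expectation M f"
proof (rule ccontr)
  assume "\<not> ?thesis"
  then have "measure_pmf.expectation M f < measure_pmf.expectation M f"
    using assms by (intro measure_pmf.expectation_greater integrable_measure_pmf_finite)
      (auto simp: AE_measure_pmf_iff not_le)
  then show False
    by simp
qed

lemma expectation_sum_pmf:
  fixes f :: "'i \<Rightarrow> 'a \<Rightarrow> real"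
  assumes "finite (set_pmf M)"
  shows "measure_pmf.expectation M (\<lambda>x. \<Sum>i\<in>I. f i x) = (\<Sum>i\<in>I. measure_pmf.expectation M (f i))"
  using assms by (intro Bochner_Integration.integral_sum integrable_measure_pmf_finite)

lemma expectation_card_pmf:
  assumes "finite (set_pmf M)" "finite A" "\<And>x. S x \<subseteq> A"
  shows "measure_pmf.expectation M (\<lambda>x. real (card (S x))) = (\<Sum>a\<in>A. measure_pmf.prob M {x. a \<in> S x})"
proof -
  have "real (card (S x)) = (\<Sum>a\<in>A. indicator {x. a \<in> S x} x)" for x
    using assms(2,3) by (simp add: indicator_def Int_absorb1)
  then show ?thesis
    by (simp add: expectation_sum_pmf[OF assms(1)])
qed

lemma map_pmf_pair_Pi_pmf:
  assumes "finite A" "x \<in> A" "y \<in> A" "x \<noteq> y"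
  shows "map_pmf (\<lambda>f. (f x, f y)) (Pi_pmf A dflt p) = pair_pmf (p x) (p y)"
proof -
  have "Pi_pmf A dflt p = map_pmf (\<lambda>(z, f). f(x := z)) (pair_pmf (p x) (Pi_pmf (A - {x}) dflt p))"
    using assms Pi_pmf_insert[of "A - {x}" x dflt p] by (simp add: insert_absorb)
  then have "map_pmf (\<lambda>f. (f x, f y)) (Pi_pmf A dflt p)
      = map_pmf (\<lambda>(z, f). (z, f y)) (pair_pmf (p x) (Pi_pmf (A - {x}) dflt p))"
    using assms(4) by (simp add: map_pmf_comp case_prod_unfold)
  also have "\<dots> = pair_pmf (p x) (map_pmf (\<lambda>f. f y) (Pi_pmf (A - {x}) dflt p))"
    using map_pair[of "\<lambda>z. z" "\<lambda>f. f y" "p x" "Pi_pmf (A - {x}) dflt p"] by (simp add: case_prod_unfold)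
  finally show ?thesis
    using assms by (simp add: Pi_pmf_component)
qed

lemma pair_pmf_of_set:
  assumes "finite A" "A \<noteq> {}" "finite B" "B \<noteq> {}"
  shows "pair_pmf (pmf_of_set A) (pmf_of_set B) = pmf_of_set (A \<times> B)"
proof (rule pmf_eqI)
  fix e show "pmf (pair_pmf (pmf_of_set A) (pmf_of_set B)) e = pmf (pmf_of_set (A \<times> B)) e"
    using assms by (cases e) (simp add: pmf_pair card_cartesian_product indicator_def)
qed

definition random_subset :: "real \<Rightarrow> 'a set \<Rightarrow> 'a set pmf" where
  "random_subset p X = map_pmf (\<lambda>f. {x \<in> X. f x}) (Pi_pmf X False (\<lambda>_. bernoulli_pmf p))"

lemma set_pmf_random_subset: "set_pmf (random_subset p X) \<subseteq> Pow X"
  by (auto simp: random_subset_def)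

lemma finite_set_pmf_random_subset: "finite X \<Longrightarrow> finite (set_pmf (random_subset p X))"
  by (meson finite_Pow_iff finite_subset set_pmf_random_subset)

lemma prob_random_subset_mem:
  assumes "finite X" "x \<in> X" "0 \<le> p" "p \<le> 1"
  shows "measure_pmf.prob (random_subset p X) {C. x \<in> C} = p"
proof -
  have "measure_pmf.prob (random_subset p X) {C. x \<in> C}
      = pmf (map_pmf (\<lambda>f. f x) (Pi_pmf X False (\<lambda>_. bernoulli_pmf p))) True"
    using assms(2) by (simp add: random_subset_def pmf_map vimage_def)
  then show ?thesis
    using assms by (simp add: Pi_pmf_component)
qed

lemma prob_random_subset_pair:
  assumes "finite X" "x \<in> X" "y \<in> X" "x \<noteq> y"
  shows "measure_pmf.prob (random_subset p X) {C. (x \<in> C) = a \<and> (y \<in> C) = b}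
    = pmf (bernoulli_pmf p) a * pmf (bernoulli_pmf p) b"
proof -
  have "measure_pmf.prob (random_subset p X) {C. (x \<in> C) = a \<and> (y \<in> C) = b}
      = pmf (map_pmf (\<lambda>f. (f x, f y)) (Pi_pmf X False (\<lambda>_. bernoulli_pmf p))) (a, b)"
    using assms by (simp add: random_subset_def pmf_map vimage_def)
  then show ?thesis
    using assms by (simp add: map_pmf_pair_Pi_pmf pmf_pair)
qed

lemma expectation_card_Int_random_subset:
  assumes "finite X" "A \<subseteq> X" "0 \<le> p" "p \<le> 1"
  shows "measure_pmf.expectation (random_subset p X) (\<lambda>C. real (card (A \<inter> C))) = p * card A"
proof -
  have "finite A"
    using assms by (auto intro: finite_subset)
  then show ?thesis
    using assms expectation_card_pmf[OF finite_set_pmf_random_subset[OF assms(1)], of A "\<lambda>C. A \<inter> C" p]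
    by (simp add: prob_random_subset_mem subset_eq)
qed

lemma variance_card_Int_random_subset:
  assumes "finite X" "A \<subseteq> X" "0 \<le> p" "p \<le> 1"
  shows "measure_pmf.variance (random_subset p X) (\<lambda>C. real (card (A \<inter> C))) = p * (1 - p) * card A"
proof -
  let ?M = "random_subset p X"
  have finA: "finite A"
    using assms by (auto intro: finite_subset)
  have integrable: "integrable ?M f" for f :: "'a set \<Rightarrow> real"
    using assms by (intro integrable_measure_pmf_finite finite_set_pmf_random_subset)
  have prob: "measure_pmf.prob ?M {C. x \<in> C \<and> y \<in> C} = (if x = y then p else p\<^sup>2)"
    if "x \<in> A" "y \<in> A" for x y
    using that assms prob_random_subset_mem[of X x p] prob_random_subset_pair[of X x y p True True]
    by (auto simp: power2_eq_square subset_eq)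
  have "measure_pmf.expectation ?M (\<lambda>C. (real (card (A \<inter> C)))\<^sup>2)
      = measure_pmf.expectation ?M (\<lambda>C. card ((A \<inter> C) \<times> (A \<inter> C)))"
    by (simp add: power2_eq_square card_cartesian_product)
  also have "\<dots> = (\<Sum>q\<in>A \<times> A. measure_pmf.prob ?M {C. q \<in> (A \<inter> C) \<times> (A \<inter> C)})"
    using assms finA by (intro expectation_card_pmf finite_set_pmf_random_subset) auto
  also have "\<dots> = (\<Sum>x\<in>A. \<Sum>y\<in>A. if x = y then p else p\<^sup>2)"
    unfolding sum.cartesian_product by (intro sum.cong) (auto simp: prob)
  also have "\<dots> = (\<Sum>x\<in>A. p\<^sup>2 * card A + (p - p\<^sup>2))"
  proof (rule sum.cong[OF refl])
    fix x assume "x \<in> A"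
    have "(\<Sum>y\<in>A. if x = y then p else p\<^sup>2) = (\<Sum>y\<in>A. p\<^sup>2 + (if x = y then p - p\<^sup>2 else 0))"
      by (intro sum.cong) auto
    then show "(\<Sum>y\<in>A. if x = y then p else p\<^sup>2) = p\<^sup>2 * card A + (p - p\<^sup>2)"
      using finA \<open>x \<in> A\<close> by (simp add: sum.distrib mult.commute)
  qed
  finally have square: "measure_pmf.expectation ?M (\<lambda>C. (real (card (A \<inter> C)))\<^sup>2)
    = (\<Sum>x\<in>A. p\<^sup>2 * card A + (p - p\<^sup>2))" .
  have "measure_pmf.variance ?M (\<lambda>C. real (card (A \<inter> C)))
      = measure_pmf.expectation ?M (\<lambda>C. (real (card (A \<inter> C)))\<^sup>2)
        - (measure_pmf.expectation ?M (\<lambda>C. real (card (A \<inter> C))))\<^sup>2"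
    by (rule measure_pmf.variance_eq[OF integrable integrable])
  also have "\<dots> = p * (1 - p) * card A"
    unfolding square expectation_card_Int_random_subset[OF assms]
    by (simp add: power2_eq_square algebra_simps)
  finally show ?thesis .
qed

lemma prob_random_subset_sparse_le:
  fixes p :: real
  assumes "finite X" "A \<subseteq> X" "A \<noteq> {}" "0 < p" "p \<le> 1"
  shows "measure_pmf.prob (random_subset p X) {C. card (A \<inter> C) < p * card A / 2} \<le> 4 / (p * card A)"
proof -
  let ?M = "random_subset p X" and ?n = "\<lambda>C. real (card (A \<inter> C))"
  have card_pos: "0 < card A"
    using assms by (auto simp: card_gt_0_iff intro: finite_subset)
  have mean: "measure_pmf.expectation ?M ?n = p * card A"
    and variance: "measure_pmf.variance ?M ?n = p * (1 - p) * card A"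
    using assms by (intro expectation_card_Int_random_subset variance_card_Int_random_subset; simp)+
  have "measure_pmf.prob ?M {C. ?n C < p * card A / 2}
      \<le> measure_pmf.prob ?M {C. p * card A / 2 \<le> \<bar>?n C - measure_pmf.expectation ?M ?n\<bar>}"
    unfolding mean by (intro measure_pmf.finite_measure_mono) auto
  also have "\<dots> \<le> measure_pmf.variance ?M ?n / (p * card A / 2)\<^sup>2"
    using measure_pmf.Chebyshev_inequality[of ?n ?M "p * card A / 2"] assms card_pos
      integrable_measure_pmf_finite[OF finite_set_pmf_random_subset[OF assms(1)], of p "\<lambda>C. (?n C)\<^sup>2"]
    by simp
  also have "\<dots> = 4 * (1 - p) / (p * card A)"
    unfolding variance using assms card_pos by (simp add: power2_eq_square field_simps)
  also have "\<dots> \<le> 4 / (p * card A)"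
    using assms by (intro divide_right_mono) auto
  finally show ?thesis .
qed

definition collisions :: "('a \<Rightarrow> 'b) \<Rightarrow> 'a set \<Rightarrow> ('a \<times> 'a) set" where
  "collisions g T = {(y, y') \<in> T \<times> T - Id. g y = g y'}"

definition overlap :: "('a \<Rightarrow> 'b set) \<Rightarrow> 'b set \<Rightarrow> 'a set \<Rightarrow> real" where
  "overlap N C T =
     (\<Sum>(y, y')\<in>T \<times> T - Id. card (N y \<inter> N y' \<inter> C) / (real (card (N y)) * real (card (N y'))))"

lemma card_le_card_image_plus_collisions:
  assumes "finite T"
  shows "card T \<le> card (g ` T) + card (collisions g T)"
proof -
  define rep where "rep y = inv_into T g (g y)" for y
  have rep: "rep y \<in> T" "g (rep y) = g y" if "y \<in> T" for y
    using that by (auto simp: rep_def inv_into_into f_inv_into_f)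
  have "inj_on (\<lambda>y. (y, rep y)) (T - rep ` T)"
    by (auto simp: inj_on_def)
  moreover have "(\<lambda>y. (y, rep y)) ` (T - rep ` T) \<subseteq> collisions g T"
    using rep by (force simp: collisions_def)
  moreover have "finite (collisions g T)"
    using assms by (auto simp: collisions_def intro: finite_subset[of _ "T \<times> T"])
  ultimately have "card (T - rep ` T) \<le> card (collisions g T)"
    by (metis card_image card_mono)
  moreover have "rep ` T = inv_into T g ` g ` T"
    by (auto simp: rep_def)
  then have "card (rep ` T) \<le> card (g ` T)"
    using assms by (simp add: card_image_le)
  moreover have "card T = card (rep ` T) + card (T - rep ` T)"
    using assms rep by (subst card_Un_disjoint[symmetric]) (auto intro!: arg_cong[of _ _ card])
  ultimately show ?thesis
    by linarith
qed

lemma prob_eq_Pi_pmf_of_set: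
  assumes "finite A" "y \<in> A" "y' \<in> A" "y \<noteq> y'"
    and L: "finite (L y)" "L y \<noteq> {}" "finite (L y')" "L y' \<noteq> {}"
  shows "measure_pmf.prob (Pi_pmf A dflt (\<lambda>y. pmf_of_set (L y))) {g. g y = g y'}
    = card (L y \<inter> L y') / (real (card (L y)) * real (card (L y')))"
proof -
  have "measure_pmf.prob (Pi_pmf A dflt (\<lambda>y. pmf_of_set (L y))) {g. g y = g y'}
      = measure_pmf.prob (map_pmf (\<lambda>g. (g y, g y')) (Pi_pmf A dflt (\<lambda>y. pmf_of_set (L y)))) {(e, e'). e = e'}"
    by (simp add: vimage_def)
  also have "\<dots> = measure_pmf.prob (pmf_of_set (L y \<times> L y')) {(e, e'). e = e'}"
    using assms by (simp add: map_pmf_pair_Pi_pmf pair_pmf_of_set)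
  also have "\<dots> = card (L y \<times> L y' \<inter> {(e, e'). e = e'}) / card (L y \<times> L y')"
    using L by (intro measure_pmf_of_set) auto
  also have "L y \<times> L y' \<inter> {(e, e'). e = e'} = (\<lambda>e. (e, e)) ` (L y \<inter> L y')"
    by auto
  finally show ?thesis
    by (simp add: card_image inj_on_def card_cartesian_product)
qed

lemma expectation_card_collisions:
  assumes A: "finite A" "T \<subseteq> A" and L: "\<And>y. y \<in> A \<Longrightarrow> finite (L y) \<and> L y \<noteq> {}"
  shows "measure_pmf.expectation (Pi_pmf A dflt (\<lambda>y. pmf_of_set (L y))) (\<lambda>g. real (card (collisions g T)))
    = overlap L UNIV T"
proof -
  let ?M = "Pi_pmf A dflt (\<lambda>y. pmf_of_set (L y))"
  have "finite T"
    using A by (rule rev_finite_subset)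
  moreover have "finite (set_pmf ?M)"
    using A(1) L by (simp add: set_Pi_pmf finite_PiE_dflt)
  ultimately have "measure_pmf.expectation ?M (\<lambda>g. real (card (collisions g T)))
      = (\<Sum>q\<in>T \<times> T - Id. measure_pmf.prob ?M {g. q \<in> collisions g T})"
    by (intro expectation_card_pmf) (auto simp: collisions_def)
  also have "\<dots> = overlap L UNIV T"
    unfolding overlap_def
  proof (rule sum.cong[OF refl])
    fix q assume "q \<in> T \<times> T - Id"
    then obtain y y' where q: "q = (y, y')" "y \<in> T" "y' \<in> T" "y \<noteq> y'"
      by (cases q) auto
    have collide: "{g. (y, y') \<in> collisions g T} = {g. g y = g y'}"
      using q by (auto simp: collisions_def)
    have "y \<in> A" "y' \<in> A"
      using q A(2) by auto
    then show "measure_pmf.prob ?M {g. q \<in> collisions g T}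
        = (case q of (y, y') \<Rightarrow> card (L y \<inter> L y' \<inter> UNIV) / (real (card (L y)) * real (card (L y'))))"
      unfolding q(1) collide using prob_eq_Pi_pmf_of_set[OF A(1), of y y' L dflt] q(4) L by simp
  qed
  finally show ?thesis .
qed

lemma exists_choice_few_collisions:
  fixes L :: "'a \<Rightarrow> 'b set" and T :: "'c \<Rightarrow> 'a set"
  assumes A: "finite A" "\<And>i. i \<in> I \<Longrightarrow> T i \<subseteq> A" and L: "\<And>y. y \<in> A \<Longrightarrow> finite (L y) \<and> L y \<noteq> {}"
  shows "\<exists>g. (\<forall>y\<in>A. g y \<in> L y) \<and>
    (\<Sum>i\<in>I. real (card (collisions g (T i)))) \<le> (\<Sum>i\<in>I. overlap L UNIV (T i))"
proof -
  define M where "M = Pi_pmf A undefined (\<lambda>y. pmf_of_set (L y))"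
  have M: "set_pmf M = PiE_dflt A undefined L"
    using A L by (auto simp: M_def set_Pi_pmf PiE_dflt_def)
  then have fin: "finite (set_pmf M)"
    using A L by auto
  have "measure_pmf.expectation M (\<lambda>g. \<Sum>i\<in>I. real (card (collisions g (T i))))
      = (\<Sum>i\<in>I. overlap L UNIV (T i))"
    unfolding expectation_sum_pmf[OF fin] unfolding M_def
    using A L by (intro sum.cong refl expectation_card_collisions)
  then obtain g where "g \<in> set_pmf M"
    "(\<Sum>i\<in>I. real (card (collisions g (T i)))) \<le> (\<Sum>i\<in>I. overlap L UNIV (T i))"
    using exists_le_expectation[OF fin, of "\<lambda>g. \<Sum>i\<in>I. real (card (collisions g (T i)))"] by auto
  then show ?thesis
    using M by (intro exI[of _ g]) (auto simp: PiE_dflt_def)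
qed

lemma overlap_nonneg: "0 \<le> overlap N C T"
  unfolding overlap_def by (intro sum_nonneg) auto

lemma expectation_overlap_random_subset:
  assumes "finite X" "\<And>y. y \<in> T \<Longrightarrow> N y \<subseteq> X" "0 \<le> p" "p \<le> 1"
  shows "measure_pmf.expectation (random_subset p X) (\<lambda>C. overlap N C T) = p * overlap N UNIV T"
proof -
  let ?D = "\<lambda>y y'. real (card (N y)) * real (card (N y'))"
  have "measure_pmf.expectation (random_subset p X) (\<lambda>C. overlap N C T)
      = (\<Sum>(y, y')\<in>T \<times> T - Id.
          measure_pmf.expectation (random_subset p X) (\<lambda>C. card (N y \<inter> N y' \<inter> C) / ?D y y'))"
    unfolding overlap_def expectation_sum_pmf[OF finite_set_pmf_random_subset[OF assms(1)]]
    by (simp add: case_prod_unfold)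
  also have "\<dots> = (\<Sum>(y, y')\<in>T \<times> T - Id. p * (card (N y \<inter> N y') / ?D y y'))"
  proof (rule sum.cong[OF refl])
    fix q assume "q \<in> T \<times> T - Id"
    then obtain y y' where q: "q = (y, y')" "N y \<inter> N y' \<subseteq> X"
      using assms(2) by (cases q) auto
    then show "(case q of (y, y') \<Rightarrow>
          measure_pmf.expectation (random_subset p X) (\<lambda>C. card (N y \<inter> N y' \<inter> C) / ?D y y'))
        = (case q of (y, y') \<Rightarrow> p * (card (N y \<inter> N y') / ?D y y'))"
      using assms by (simp add: expectation_card_Int_random_subset)
  qed
  finally show ?thesis
    by (simp add: overlap_def sum_distrib_left case_prod_unfold)
qed

lemma overlap_restrict_le:
  fixes p :: real
  assumes "finite T" "T' \<subseteq> T" "0 < p" and finN: "\<And>y. y \<in> T' \<Longrightarrow> finite (N y)"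
    and half: "\<And>y. y \<in> T' \<Longrightarrow> p * card (N y) / 2 \<le> card (N y \<inter> C)"
  shows "overlap (\<lambda>y. N y \<inter> C) UNIV T' \<le> 4 / p\<^sup>2 * overlap N C T"
proof -
  let ?D = "\<lambda>y. real (card (N y))" and ?D' = "\<lambda>y. real (card (N y \<inter> C))"
  have "overlap (\<lambda>y. N y \<inter> C) UNIV T'
      \<le> (\<Sum>(y, y')\<in>T' \<times> T' - Id. 4 / p\<^sup>2 * (card (N y \<inter> N y' \<inter> C) / (?D y * ?D y')))"
    unfolding overlap_def
  proof (rule sum_mono)
    fix q assume "q \<in> T' \<times> T' - Id"
    then obtain y y' where q: "q = (y, y')" and y: "y \<in> T'" "y' \<in> T'"
      by (cases q) auto
    have eq: "(N y \<inter> C) \<inter> (N y' \<inter> C) \<inter> UNIV = N y \<inter> N y' \<inter> C"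
      by auto
    have "card ((N y \<inter> C) \<inter> (N y' \<inter> C) \<inter> UNIV) / (?D' y * ?D' y')
        \<le> 4 / p\<^sup>2 * (card (N y \<inter> N y' \<inter> C) / (?D y * ?D y'))"
    proof (cases "N y = {} \<or> N y' = {}")
      case False
      then have "0 < ?D y" "0 < ?D y'"
        using finN y by (auto simp: card_gt_0_iff)
      then have "0 < (p * ?D y / 2) * (p * ?D y' / 2)"
        using assms(3) by simp
      moreover have "(p * ?D y / 2) * (p * ?D y' / 2) \<le> ?D' y * ?D' y'"
        using assms(3) by (intro mult_mono half y) auto
      ultimately have "card (N y \<inter> N y' \<inter> C) / (?D' y * ?D' y')
          \<le> card (N y \<inter> N y' \<inter> C) / ((p * ?D y / 2) * (p * ?D y' / 2))"
        by (intro frac_le) auto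
      then show ?thesis
        unfolding eq by (simp add: power2_eq_square mult_ac)
    qed auto
    then show "(case q of (y, y') \<Rightarrow> card ((N y \<inter> C) \<inter> (N y' \<inter> C) \<inter> UNIV) / (?D' y * ?D' y'))
        \<le> (case q of (y, y') \<Rightarrow> 4 / p\<^sup>2 * (card (N y \<inter> N y' \<inter> C) / (?D y * ?D y')))"
      by (simp add: q)
  qed
  also have "\<dots> \<le> (\<Sum>(y, y')\<in>T \<times> T - Id. 4 / p\<^sup>2 * (card (N y \<inter> N y' \<inter> C) / (?D y * ?D y')))"
    using assms(1,2) by (intro sum_mono2) auto
  also have "\<dots> = 4 / p\<^sup>2 * overlap N C T"
    by (simp add: overlap_def sum_distrib_left case_prod_unfold)
  finally show ?thesis .
qed

subsection \<open>Grouping targets around random centres\<close>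

text \<open>The targets \<open>T i\<close> of star \<open>i\<close> are grouped around random centres of density \<open>p\<close>. Star \<open>i\<close> reaches
  its target \<open>y\<close> through the leaf \<open>\<xi> i y\<close>, and so loses it when that leaf becomes a centre itself.\<close>

locale set_grouping =
  fixes X :: "'a set" and I :: "'i set" and T :: "'i \<Rightarrow> 'b set"
    and N :: "'b \<Rightarrow> 'a set" and \<xi> :: "'i \<Rightarrow> 'b \<Rightarrow> 'a" and p d :: real
  assumes finite_ground: "finite X" and finite_index: "finite I"
    and finite_target: "\<And>i. i \<in> I \<Longrightarrow> finite (T i)"
    and nbrs_subset: "\<And>i y. i \<in> I \<Longrightarrow> y \<in> T i \<Longrightarrow> N y \<subseteq> X"
    and degree_ge: "\<And>i y. i \<in> I \<Longrightarrow> y \<in> T i \<Longrightarrow> d \<le> card (N y)"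
    and link_mem: "\<And>i y. i \<in> I \<Longrightarrow> y \<in> T i \<Longrightarrow> \<xi> i y \<in> X"
    and density: "0 < p" "p \<le> 1 / 16" "64 \<le> p * d"
    and targets_nonempty: "0 < (\<Sum>i\<in>I. card (T i))"
    and overlap_le: "(\<Sum>i\<in>I. overlap N UNIV (T i)) \<le> p / 32 * (\<Sum>i\<in>I. card (T i))"
begin

abbreviation total :: real where
  "total \<equiv> \<Sum>i\<in>I. card (T i)"

definition spoiled :: "'a set \<Rightarrow> 'i \<Rightarrow> 'b set" where
  "spoiled C i = {y \<in> T i. \<xi> i y \<in> C \<or> card (N y \<inter> C) < p * card (N y) / 2}"

lemma degree_pos: "0 < d"
  using density by (metis less_le_trans zero_less_mult_pos zero_less_numeral)

lemma prob_spoiled_le: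
  assumes "i \<in> I" "y \<in> T i"
  shows "measure_pmf.prob (random_subset p X) {C. y \<in> spoiled C i} \<le> 1 / 8"
proof -
  let ?M = "random_subset p X"
  have "N y \<noteq> {}"
    using degree_ge[OF assms] degree_pos by auto
  then have "measure_pmf.prob ?M {C. card (N y \<inter> C) < p * card (N y) / 2} \<le> 4 / (p * card (N y))"
    using density nbrs_subset[OF assms] finite_ground by (intro prob_random_subset_sparse_le) auto
  also have "\<dots> \<le> 4 / (p * d)"
    using density degree_pos degree_ge[OF assms] by (intro divide_left_mono mult_left_mono mult_pos_pos) auto
  also have "\<dots> \<le> 4 / 64"
    using density by (intro divide_left_mono) auto
  finally have sparse: "measure_pmf.prob ?M {C. card (N y \<inter> C) < p * card (N y) / 2} \<le> 1 / 16"
    by simp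
  have "measure_pmf.prob ?M {C. \<xi> i y \<in> C} = p"
    using density link_mem[OF assms] finite_ground by (intro prob_random_subset_mem) auto
  moreover have "measure_pmf.prob ?M {C. y \<in> spoiled C i}
      \<le> measure_pmf.prob ?M {C. \<xi> i y \<in> C}
        + measure_pmf.prob ?M {C. card (N y \<inter> C) < p * card (N y) / 2}"
    using assms measure_Un_le[of "{C. \<xi> i y \<in> C}" "measure_pmf ?M" "{C. card (N y \<inter> C) < p * card (N y) / 2}"]
    by (simp add: spoiled_def Un_def)
  ultimately show ?thesis
    using sparse density by linarith
qed

lemma expectation_spoiled_le:
  "measure_pmf.expectation (random_subset p X) (\<lambda>C. \<Sum>i\<in>I. real (card (spoiled C i))) \<le> total / 8"
proof -
  let ?M = "random_subset p X"
  have fin: "finite (set_pmf ?M)"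
    using finite_ground by (rule finite_set_pmf_random_subset)
  have "measure_pmf.expectation ?M (\<lambda>C. real (card (spoiled C i))) \<le> card (T i) / 8" if "i \<in> I" for i
  proof -
    have "measure_pmf.expectation ?M (\<lambda>C. real (card (spoiled C i)))
        = (\<Sum>y\<in>T i. measure_pmf.prob ?M {C. y \<in> spoiled C i})"
      using that by (intro expectation_card_pmf fin finite_target) (auto simp: spoiled_def)
    also have "\<dots> \<le> (\<Sum>y\<in>T i. 1 / 8)"
      using that by (intro sum_mono prob_spoiled_le)
    finally show ?thesis
      by simp
  qed
  then have "(\<Sum>i\<in>I. measure_pmf.expectation ?M (\<lambda>C. real (card (spoiled C i)))) \<le> (\<Sum>i\<in>I. card (T i) / 8)"
    by (rule sum_mono)
  then show ?thesis
    by (simp add: expectation_sum_pmf[OF fin] sum_divide_distrib)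
qed

lemma expectation_overlaps_le:
  "measure_pmf.expectation (random_subset p X) (\<lambda>C. 4 / p\<^sup>2 * (\<Sum>i\<in>I. overlap N C (T i))) \<le> total / 8"
proof -
  let ?M = "random_subset p X"
  have fin: "finite (set_pmf ?M)"
    using finite_ground by (rule finite_set_pmf_random_subset)
  have "measure_pmf.expectation ?M (\<lambda>C. overlap N C (T i)) = p * overlap N UNIV (T i)" if "i \<in> I" for i
    using finite_ground nbrs_subset[OF that] density by (intro expectation_overlap_random_subset) auto
  then have "measure_pmf.expectation ?M (\<lambda>C. 4 / p\<^sup>2 * (\<Sum>i\<in>I. overlap N C (T i)))
      = 4 / p\<^sup>2 * (\<Sum>i\<in>I. p * overlap N UNIV (T i))"
    by (simp add: expectation_sum_pmf[OF fin])
  also have "\<dots> = 4 / p * (\<Sum>i\<in>I. overlap N UNIV (T i))"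
    using density(1) by (simp add: power2_eq_square flip: sum_distrib_left)
  also have "\<dots> \<le> 4 / p * (p / 32 * total)"
    using density(1) by (intro mult_left_mono overlap_le) auto
  finally show ?thesis
    using density(1) by simp
qed

text \<open>A single functional measures spoiled targets, collisions and the number of centres at once,
  so that one choice of centres is good for all three.\<close>

lemma exists_good_centres:
  "\<exists>C\<subseteq>X. real (card C) \<le> 4 * p * card X \<and>
    (\<Sum>i\<in>I. real (card (spoiled C i))) + 4 / p\<^sup>2 * (\<Sum>i\<in>I. overlap N C (T i)) \<le> total / 2"
proof -
  let ?M = "random_subset p X"
  define cost where "cost C = (\<Sum>i\<in>I. real (card (spoiled C i))) + 4 / p\<^sup>2 * (\<Sum>i\<in>I. overlap N C (T i))" for C
  define size where "size C = total / (8 * p * card X) * card (X \<inter> C)" for C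
  have "X \<noteq> {}"
    using targets_nonempty link_mem by fastforce
  then have card_pos: "0 < card X"
    using finite_ground by (simp add: card_gt_0_iff)
  have total_pos: "0 < total"
    using targets_nonempty by linarith
  have fin: "finite (set_pmf ?M)"
    using finite_ground by (rule finite_set_pmf_random_subset)
  have "measure_pmf.expectation ?M size
      = total / (8 * p * card X) * measure_pmf.expectation ?M (\<lambda>C. real (card (X \<inter> C)))"
    unfolding size_def by (rule integral_mult_right_zero)
  also have "\<dots> = total / (8 * p * card X) * (p * card X)"
    using finite_ground density by (subst expectation_card_Int_random_subset) auto
  also have "\<dots> = total / 8"
    using density(1) card_pos by simp
  finally have "measure_pmf.expectation ?M (\<lambda>C. cost C + size C) \<le> total / 2"
    using expectation_spoiled_le expectation_overlaps_le total_pos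
    unfolding cost_def by (simp add: integrable_measure_pmf_finite[OF fin])
  then obtain C where C: "C \<in> set_pmf ?M" "cost C + size C \<le> total / 2"
    using exists_le_expectation[OF fin, of "\<lambda>C. cost C + size C"] by fastforce
  have nonneg: "0 \<le> cost C" "0 \<le> size C"
    using total_pos density(1) unfolding cost_def size_def
    by (intro add_nonneg_nonneg sum_nonneg mult_nonneg_nonneg overlap_nonneg; simp)+
  have "C \<subseteq> X"
    using C(1) set_pmf_random_subset by blast
  then have "total / (8 * p * card X) * card C \<le> total / 2"
    using C(2) nonneg by (simp add: size_def Int_absorb1)
  then have "real (card C) \<le> 4 * p * card X"
    using total_pos card_pos density by (simp add: field_simps)
  then show ?thesis
    using C(2) nonneg(2) \<open>C \<subseteq> X\<close> unfolding cost_def by (intro exI[of _ C]) auto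
qed

definition covered :: "'a set \<Rightarrow> 'b set" where
  "covered C = {y \<in> \<Union> (T ` I). p * card (N y) / 2 \<le> card (N y \<inter> C)}"

lemma unspoiled_eq:
  assumes "i \<in> I"
  shows "T i - spoiled C i = {y \<in> T i \<inter> covered C. \<xi> i y \<notin> C}"
  using assms by (auto simp: covered_def spoiled_def)

lemma covered_nbrs:
  assumes "y \<in> covered C"
  shows "finite (N y)" "N y \<inter> C \<noteq> {}"
proof -
  obtain i where i: "i \<in> I" "y \<in> T i"
    using assms unfolding covered_def by blast
  show "finite (N y)"
    using nbrs_subset[OF i] finite_ground by (rule finite_subset)
  have "0 < p * card (N y) / 2"
    using density(1) degree_pos degree_ge[OF i] by simp
  also have "\<dots> \<le> card (N y \<inter> C)"
    using assms by (simp add: covered_def)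
  finally show "N y \<inter> C \<noteq> {}"
    by auto
qed

lemma card_unspoiled_le:
  assumes i: "i \<in> I"
  shows "real (card (T i)) \<le> card (g ` (T i - spoiled C i)) + real (card (collisions g (T i - spoiled C i)))
    + card (spoiled C i)"
proof -
  have sub: "spoiled C i \<subseteq> T i"
    by (auto simp: spoiled_def)
  have "card (T i - spoiled C i) = card (T i) - card (spoiled C i)"
    using finite_subset[OF sub finite_target[OF i]] sub by (rule card_Diff_subset)
  then have "card (T i) = card (spoiled C i) + card (T i - spoiled C i)"
    using card_mono[OF finite_target[OF i] sub] by simp
  moreover have "card (T i - spoiled C i)
      \<le> card (g ` (T i - spoiled C i)) + card (collisions g (T i - spoiled C i))"
    using finite_target[OF i] by (intro card_le_card_image_plus_collisions finite_Diff)
  ultimately show ?thesis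
    by linarith
qed

lemma overlap_unspoiled_le:
  assumes i: "i \<in> I"
  shows "overlap (\<lambda>y. N y \<inter> C) UNIV (T i - spoiled C i) \<le> 4 / p\<^sup>2 * overlap N C (T i)"
proof (rule overlap_restrict_le[OF finite_target[OF i] Diff_subset density(1)])
  fix y assume "y \<in> T i - spoiled C i"
  then have covered: "y \<in> covered C"
    unfolding unspoiled_eq[OF i] by simp
  then show "finite (N y)"
    by (rule covered_nbrs)
  show "p * card (N y) / 2 \<le> card (N y \<inter> C)"
    using covered by (simp add: covered_def)
qed

lemma exists_grouping:
  "\<exists>C g H. C \<subseteq> X \<and> real (card C) \<le> 4 * p * card X \<and> H \<subseteq> \<Union> (T ` I) \<and> (\<forall>y\<in>H. g y \<in> N y \<inter> C) \<and>
    total / 2 \<le> (\<Sum>i\<in>I. card (g ` {y \<in> T i \<inter> H. \<xi> i y \<notin> C}))"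
proof -
  obtain C where C: "C \<subseteq> X" "real (card C) \<le> 4 * p * card X"
    "(\<Sum>i\<in>I. real (card (spoiled C i))) + 4 / p\<^sup>2 * (\<Sum>i\<in>I. overlap N C (T i)) \<le> total / 2"
    using exists_good_centres by blast
  define B where "B i = T i - spoiled C i" for i
  have "finite (covered C)"
    using finite_index finite_target by (simp add: covered_def)
  moreover have "B i \<subseteq> covered C" if "i \<in> I" for i
    unfolding B_def unspoiled_eq[OF that] by auto
  moreover have "finite (N y \<inter> C) \<and> N y \<inter> C \<noteq> {}" if "y \<in> covered C" for y
    using covered_nbrs[OF that] by simp
  ultimately have "\<exists>g. (\<forall>y\<in>covered C. g y \<in> N y \<inter> C) \<and>
      (\<Sum>i\<in>I. real (card (collisions g (B i)))) \<le> (\<Sum>i\<in>I. overlap (\<lambda>y. N y \<inter> C) UNIV (B i))"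
    by (rule exists_choice_few_collisions)
  then obtain g where g: "\<forall>y\<in>covered C. g y \<in> N y \<inter> C"
    and few: "(\<Sum>i\<in>I. real (card (collisions g (B i)))) \<le> (\<Sum>i\<in>I. overlap (\<lambda>y. N y \<inter> C) UNIV (B i))"
    by blast
  have "(\<Sum>i\<in>I. overlap (\<lambda>y. N y \<inter> C) UNIV (B i)) \<le> 4 / p\<^sup>2 * (\<Sum>i\<in>I. overlap N C (T i))"
    unfolding B_def sum_distrib_left by (intro sum_mono overlap_unspoiled_le)
  moreover have "total \<le> (\<Sum>i\<in>I. card (g ` B i)) + (\<Sum>i\<in>I. real (card (collisions g (B i))))
      + (\<Sum>i\<in>I. real (card (spoiled C i)))"
    unfolding B_def of_nat_sum sum.distrib[symmetric] by (intro sum_mono card_unspoiled_le)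
  ultimately have "total / 2 \<le> (\<Sum>i\<in>I. card (g ` B i))"
    using C(3) few by linarith
  also have "(\<Sum>i\<in>I. card (g ` B i)) = (\<Sum>i\<in>I. card (g ` {y \<in> T i \<inter> covered C. \<xi> i y \<notin> C}))"
    by (intro sum.cong refl) (simp add: B_def unspoiled_eq)
  finally show ?thesis
    using C(1,2) g by (intro exI[of _ C] exI[of _ g] exI[of _ "covered C"]) (auto simp: covered_def)
qed

end

subsection \<open>Bounded codegrees\<close>

definition codegree_bounded :: "nat \<Rightarrow> nat \<Rightarrow> ('b \<Rightarrow> 'a set) \<Rightarrow> 'a set \<Rightarrow> 'b set \<Rightarrow> bool" where
  "codegree_bounded s k M S T \<longleftrightarrow> (\<forall>A\<subseteq>S. card A = s \<longrightarrow> card {y \<in> T. A \<subseteq> M y} \<le> k)"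

lemma codegree_bounded_subset:
  assumes "codegree_bounded s k M S T" "S' \<subseteq> S" "T' \<subseteq> T" "finite T"
  shows "codegree_bounded s k M S' T'"
  unfolding codegree_bounded_def
proof (intro allI impI)
  fix A assume A: "A \<subseteq> S'" "card A = s"
  have "card {y \<in> T'. A \<subseteq> M y} \<le> card {y \<in> T. A \<subseteq> M y}"
    using assms(3,4) by (intro card_mono) auto
  also have "\<dots> \<le> k"
    using assms(1,2) A by (auto simp: codegree_bounded_def)
  finally show "card {y \<in> T'. A \<subseteq> M y} \<le> k" .
qed

lemma sum_choose_le:
  assumes "finite S" "finite T" "codegree_bounded s k M S T"
  shows "(\<Sum>y\<in>T. card (M y \<inter> S) choose s) \<le> k * (card S choose s)"
proof -
  define P where "P = {A. A \<subseteq> S \<and> card A = s}"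
  have finP: "finite P"
    using assms(1) by (simp add: P_def)
  have "card (M y \<inter> S) choose s = card {A \<in> P. A \<subseteq> M y}" for y
  proof -
    have "card (M y \<inter> S) choose s = card {A. A \<subseteq> M y \<inter> S \<and> card A = s}"
      using assms(1) by (intro n_subsets[symmetric]) auto
    also have "{A. A \<subseteq> M y \<inter> S \<and> card A = s} = {A \<in> P. A \<subseteq> M y}"
      by (auto simp: P_def)
    finally show ?thesis .
  qed
  then have "(\<Sum>y\<in>T. card (M y \<inter> S) choose s) = (\<Sum>A\<in>P. card {y \<in> T. A \<subseteq> M y})"
    using sum_multicount_gen[OF assms(2) finP, of "\<lambda>y A. A \<subseteq> M y"] by simp
  also have "\<dots> \<le> (\<Sum>A\<in>P. k)"
    using assms(3) by (intro sum_mono) (auto simp: codegree_bounded_def P_def)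
  also have "\<dots> = k * (card S choose s)"
    using n_subsets[OF assms(1), of s] by (simp add: P_def)
  finally show ?thesis .
qed

lemma sum_power_card_le:
  assumes "finite S" "finite T" "codegree_bounded s k M S T"
  shows "(\<Sum>y\<in>{y \<in> T. s \<le> card (M y \<inter> S)}. real (card (M y \<inter> S)) ^ s)
    \<le> real s ^ s * k * real (card S) ^ s"
proof -
  have "real (card (M y \<inter> S)) ^ s \<le> real s ^ s * (card (M y \<inter> S) choose s)"
    if "s \<le> card (M y \<inter> S)" for y
  proof (cases "s = 0")
    case False
    then show ?thesis
      using binomial_ge_n_over_k_pow_k[OF that, where 'a=real]
      by (simp add: field_simps)
  qed simp
  then have "(\<Sum>y\<in>{y \<in> T. s \<le> card (M y \<inter> S)}. real (card (M y \<inter> S)) ^ s)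
      \<le> (\<Sum>y\<in>{y \<in> T. s \<le> card (M y \<inter> S)}. real s ^ s * (card (M y \<inter> S) choose s))"
    by (intro sum_mono) auto
  also have "\<dots> \<le> (\<Sum>y\<in>T. real s ^ s * (card (M y \<inter> S) choose s))"
    using assms(2) by (intro sum_mono2) auto
  also have "\<dots> = real s ^ s * real (\<Sum>y\<in>T. card (M y \<inter> S) choose s)"
    by (simp add: sum_distrib_left)
  also have "\<dots> \<le> real s ^ s * real (k * (card S choose s))"
    using sum_choose_le[OF assms] by (intro mult_left_mono of_nat_mono) auto
  also have "\<dots> \<le> real s ^ s * (k * real (card S) ^ s)"
  proof -
    have "real (card S choose s) \<le> real (card S) ^ s"
    proof (cases "s \<le> card S")
      case True
      then show ?thesis
        using binomial_le_pow[of s "card S"] by (simp flip: of_nat_power)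
    qed (simp add: binomial_eq_0)
    then show ?thesis
      by (auto intro!: mult_left_mono)
  qed
  finally show ?thesis
    by simp
qed

lemma sum_card_Int_le:
  assumes fin: "finite S" "finite T" and s: "1 \<le> s" and codeg: "codegree_bounded s k M S T"
  shows "(\<Sum>y\<in>T. real (card (M y \<inter> S)))
    \<le> s * card {y \<in> T. M y \<inter> S \<noteq> {}} + real s ^ s * k * real (card S) ^ s"
proof -
  let ?m = "\<lambda>y. real (card (M y \<inter> S))"
  have "?m y \<le> real s * of_bool (M y \<inter> S \<noteq> {}) + of_bool (s \<le> card (M y \<inter> S)) * ?m y ^ s" for y
  proof (cases "M y \<inter> S = {} \<or> card (M y \<inter> S) < s")
    case False
    then have "1 \<le> ?m y"
      using s by simp
    then have "?m y \<le> ?m y ^ s"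
      using s by (intro self_le_power) auto
    then have "?m y \<le> s + ?m y ^ s"
      by (rule add_increasing[rotated]) simp
    then show ?thesis
      using False by auto
  qed auto
  then have "(\<Sum>y\<in>T. ?m y)
      \<le> (\<Sum>y\<in>T. real s * of_bool (M y \<inter> S \<noteq> {}) + of_bool (s \<le> card (M y \<inter> S)) * ?m y ^ s)"
    by (rule sum_mono)
  also have "\<dots> = s * card {y \<in> T. M y \<inter> S \<noteq> {}}
      + (\<Sum>y\<in>T. of_bool (s \<le> card (M y \<inter> S)) * ?m y ^ s)"
    using fin by (simp add: sum.distrib Collect_conj_eq flip: sum_distrib_left)
  also have "(\<Sum>y\<in>T. of_bool (s \<le> card (M y \<inter> S)) * ?m y ^ s)
      = (\<Sum>y\<in>{y \<in> T. s \<le> card (M y \<inter> S)}. ?m y ^ s)"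
    using fin by (intro sum.mono_neutral_cong_right) auto
  also have "\<dots> \<le> real s ^ s * k * real (card S) ^ s"
    by (rule sum_power_card_le[OF fin codeg])
  finally show ?thesis
    by simp
qed

text \<open>A form of the bound of Kovari, Sos and Turan.\<close>

lemma card_nbrs_ge:
  fixes d :: real
  assumes fin: "finite S" "finite T" and s: "1 \<le> s" and codeg: "codegree_bounded s k M S T"
    and degree: "card S * d \<le> (\<Sum>y\<in>T. real (card (M y \<inter> S)))"
    and small: "2 * real s ^ s * k * real (card S) ^ (s - 1) \<le> d"
  shows "card S * d \<le> 2 * s * card {y \<in> T. M y \<inter> S \<noteq> {}}"
proof -
  have "real s ^ s * k * real (card S) ^ s \<le> card S * d / 2"
  proof -
    have "real (card S) ^ s = real (card S) * real (card S) ^ (s - 1)"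
      using s by (cases s) auto
    moreover have "card S * (2 * real s ^ s * k * real (card S) ^ (s - 1)) \<le> card S * d"
      using small by (intro mult_left_mono) auto
    ultimately show ?thesis
      by (simp add: mult_ac)
  qed
  then show ?thesis
    using degree sum_card_Int_le[OF fin s codeg] by linarith
qed

definition inverse_degree_sum :: "('b \<Rightarrow> 'a set) \<Rightarrow> 'b set \<Rightarrow> 'a \<Rightarrow> real" where
  "inverse_degree_sum N T e = (\<Sum>y\<in>T. of_bool (e \<in> N y) / real (card (N y)))"

lemma inverse_degree_sum_nonneg: "0 \<le> inverse_degree_sum N T e"
  by (auto simp: inverse_degree_sum_def intro!: sum_nonneg)

lemma inverse_degree_sum_le:
  fixes d :: real
  assumes "finite T" "0 < d" "\<And>y. y \<in> T \<Longrightarrow> d \<le> card (N y)"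
  shows "inverse_degree_sum N T e \<le> card ({y. e \<in> N y} \<inter> T) / d"
proof -
  have "inverse_degree_sum N T e \<le> (\<Sum>y\<in>T. of_bool (e \<in> N y) / d)"
    unfolding inverse_degree_sum_def
    using assms(2,3) by (intro sum_mono divide_left_mono mult_pos_pos) fastforce+
  also have "\<dots> = card ({y. e \<in> N y} \<inter> T) / d"
    using assms(1) by (simp add: Int_commute flip: sum_divide_distrib)
  finally show ?thesis .
qed

lemma sum_inverse_degree_sum:
  assumes "finite X" "\<And>y. y \<in> T \<Longrightarrow> N y \<subseteq> X \<and> N y \<noteq> {}"
  shows "(\<Sum>e\<in>X. inverse_degree_sum N T e) = card T"
proof -
  have "(\<Sum>e\<in>X. of_bool (e \<in> N y) / real (card (N y))) = 1" if "y \<in> T" for y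
  proof -
    have "finite (N y)" "X \<inter> N y = N y" "N y \<noteq> {}"
      using assms(1) assms(2)[OF that] by (auto intro: finite_subset)
    then show ?thesis
      using assms(1) by (simp flip: sum_divide_distrib)
  qed
  then show ?thesis
    unfolding inverse_degree_sum_def by (subst sum.swap) simp
qed

lemma overlap_le_sum_squares:
  assumes "finite X" "finite T" "\<And>y. y \<in> T \<Longrightarrow> N y \<subseteq> X"
  shows "overlap N UNIV T \<le> (\<Sum>e\<in>X. (inverse_degree_sum N T e)\<^sup>2)"
proof -
  let ?f = "\<lambda>y e. of_bool (e \<in> N y) / real (card (N y))"
  have "overlap N UNIV T \<le> (\<Sum>(y, y')\<in>T \<times> T. card (N y \<inter> N y') / (real (card (N y)) * real (card (N y'))))"
    unfolding overlap_def Int_UNIV_right using assms(2) by (intro sum_mono2) auto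
  also have "\<dots> = (\<Sum>y\<in>T. \<Sum>y'\<in>T. card (N y \<inter> N y') / (real (card (N y)) * real (card (N y'))))"
    by (rule sum.cartesian_product[symmetric])
  also have "\<dots> = (\<Sum>y\<in>T. \<Sum>y'\<in>T. \<Sum>e\<in>X. ?f y e * ?f y' e)"
  proof (intro sum.cong refl)
    fix y y' assume "y \<in> T" "y' \<in> T"
    then have "X \<inter> {e \<in> N y. e \<in> N y'} = N y \<inter> N y'"
      using assms(3) by auto
    then have "real (card (N y \<inter> N y')) = (\<Sum>e\<in>X. of_bool (e \<in> N y \<and> e \<in> N y'))"
      using assms(1) by simp
    also have "\<dots> = (\<Sum>e\<in>X. of_bool (e \<in> N y) * of_bool (e \<in> N y'))"
      by (simp add: of_bool_conj)
    finally show "card (N y \<inter> N y') / (real (card (N y)) * real (card (N y'))) = (\<Sum>e\<in>X. ?f y e * ?f y' e)"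
      by (simp add: sum_divide_distrib)
  qed
  also have "\<dots> = (\<Sum>y\<in>T. \<Sum>e\<in>X. \<Sum>y'\<in>T. ?f y e * ?f y' e)"
    by (rule sum.cong[OF refl], rule sum.swap)
  also have "\<dots> = (\<Sum>e\<in>X. \<Sum>y\<in>T. \<Sum>y'\<in>T. ?f y e * ?f y' e)"
    by (rule sum.swap)
  also have "\<dots> = (\<Sum>e\<in>X. (inverse_degree_sum N T e)\<^sup>2)"
    by (simp add: inverse_degree_sum_def power2_eq_square sum_product)
  finally show ?thesis .
qed

lemma square_le_linear_plus_power:
  fixes x u \<tau> :: real and s :: nat
  assumes "2 \<le> s" "0 < \<tau>" "0 \<le> x" "x \<le> u"
  shows "x\<^sup>2 \<le> \<tau> * x + of_bool (\<tau> < u) * (u ^ s / \<tau> ^ (s - 2))"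
proof (cases "x \<le> \<tau>")
  case True
  then have "x * x \<le> \<tau> * x"
    using assms by (intro mult_right_mono) auto
  moreover have "0 \<le> u"
    using assms by linarith
  ultimately show ?thesis
    using assms by (simp add: power2_eq_square add_increasing2)
next
  case False
  have "x\<^sup>2 * \<tau> ^ (s - 2) \<le> x\<^sup>2 * x ^ (s - 2)"
    using False assms by (intro mult_left_mono power_mono) auto
  also have "\<dots> = x ^ (2 + (s - 2))"
    by (simp only: power_add)
  also have "2 + (s - 2) = s"
    using assms(1) by simp
  also have "x ^ s \<le> u ^ s"
    using assms by (intro power_mono) auto
  finally have "x\<^sup>2 \<le> u ^ s / \<tau> ^ (s - 2)"
    using assms by (simp add: pos_le_divide_eq)
  moreover have "\<tau> < u" "0 \<le> \<tau> * x"
    using False assms by auto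
  ultimately show ?thesis
    by simp
qed

lemma square_inverse_degree_sum_le:
  fixes \<tau> d :: real
  assumes "finite T" "\<And>y. y \<in> T \<Longrightarrow> d \<le> card (N y)" and s: "2 \<le> s"
    and pos: "0 < \<tau>" "0 < d" and d: "s \<le> \<tau> * d"
  shows "(inverse_degree_sum N T e)\<^sup>2 \<le> \<tau> * inverse_degree_sum N T e
    + of_bool (s \<le> card ({y. e \<in> N y} \<inter> T)) * (real (card ({y. e \<in> N y} \<inter> T)) ^ s / (d ^ s * \<tau> ^ (s - 2)))"
proof -
  let ?w = "inverse_degree_sum N T e" and ?c = "card ({y. e \<in> N y} \<inter> T)"
  have "?w\<^sup>2 \<le> \<tau> * ?w + of_bool (\<tau> < ?c / d) * ((?c / d) ^ s / \<tau> ^ (s - 2))"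
    using assms by (intro square_le_linear_plus_power inverse_degree_sum_nonneg inverse_degree_sum_le)
  also have "of_bool (\<tau> < ?c / d) * ((?c / d) ^ s / \<tau> ^ (s - 2))
      \<le> of_bool (s \<le> ?c) * (real ?c ^ s / (d ^ s * \<tau> ^ (s - 2)))"
  proof (cases "\<tau> < ?c / d")
    case True
    then have "\<tau> * d < ?c"
      using pos(2) by (simp add: pos_less_divide_eq)
    then have "s \<le> ?c"
      using d by linarith
    then show ?thesis
      using True by (simp add: power_divide)
  qed (use pos in simp)
  finally show ?thesis
    by simp
qed

lemma overlap_le_of_codegree_bounded:
  fixes \<tau> d :: real
  assumes fin: "finite X" "finite T" and N: "\<And>y. y \<in> T \<Longrightarrow> N y \<subseteq> X" "\<And>y. y \<in> T \<Longrightarrow> d \<le> card (N y)"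
    and s: "2 \<le> s" and codeg: "codegree_bounded s k (\<lambda>e. {y. e \<in> N y}) T X"
    and pos: "0 < \<tau>" "0 < d" and d: "s \<le> \<tau> * d"
    and small: "real s ^ s * k * real (card T) ^ (s - 1) \<le> \<tau> ^ (s - 1) * d ^ s"
  shows "overlap N UNIV T \<le> 2 * \<tau> * card T"
proof -
  let ?w = "inverse_degree_sum N T"
  define c where "c e = card ({y. e \<in> N y} \<inter> T)" for e
  have "overlap N UNIV T \<le> (\<Sum>e\<in>X. (?w e)\<^sup>2)"
    using fin N(1) by (rule overlap_le_sum_squares)
  also have "\<dots> \<le> (\<Sum>e\<in>X. \<tau> * ?w e + of_bool (s \<le> c e) * (real (c e) ^ s / (d ^ s * \<tau> ^ (s - 2))))"
    unfolding c_def by (intro sum_mono square_inverse_degree_sum_le fin(2) N(2) s pos d)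
  also have "\<dots> = \<tau> * (\<Sum>e\<in>X. ?w e) + (\<Sum>e\<in>{e \<in> X. s \<le> c e}. real (c e) ^ s) / (d ^ s * \<tau> ^ (s - 2))"
  proof -
    have "(\<Sum>e\<in>X. of_bool (s \<le> c e) * (real (c e) ^ s / (d ^ s * \<tau> ^ (s - 2))))
        = (\<Sum>e\<in>{e \<in> X. s \<le> c e}. real (c e) ^ s / (d ^ s * \<tau> ^ (s - 2)))"
      using fin by (intro sum.mono_neutral_cong_right) auto
    then show ?thesis
      by (simp add: sum.distrib sum_distrib_left sum_divide_distrib)
  qed
  also have "(\<Sum>e\<in>X. ?w e) = card T"
    using fin(1) N pos(2) by (intro sum_inverse_degree_sum) fastforce+
  also have "(\<Sum>e\<in>{e \<in> X. s \<le> c e}. real (c e) ^ s) / (d ^ s * \<tau> ^ (s - 2)) \<le> \<tau> * card T"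
  proof -
    have pow: "real (card T) ^ s = real (card T) * real (card T) ^ (s - 1)"
        "\<tau> ^ (s - 1) = \<tau> * \<tau> ^ (s - 2)"
      using s by (simp_all add: power_eq_if Suc_diff_le numeral_2_eq_2)
    have "(\<Sum>e\<in>{e \<in> X. s \<le> c e}. real (c e) ^ s) \<le> real s ^ s * k * real (card T) ^ s"
      unfolding c_def by (rule sum_power_card_le[OF fin(2,1) codeg])
    also have "\<dots> = card T * (real s ^ s * k * real (card T) ^ (s - 1))"
      unfolding pow by (simp only: mult_ac)
    also have "\<dots> \<le> card T * (\<tau> ^ (s - 1) * d ^ s)"
      using small by (intro mult_left_mono) auto
    also have "\<dots> = \<tau> * card T * (d ^ s * \<tau> ^ (s - 2))"
      unfolding pow by (simp only: mult_ac)
    finally show ?thesis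
      using pos by (simp add: pos_divide_le_eq)
  qed
  finally show ?thesis
    by simp
qed

subsection \<open>Bipartite cores and star packings\<close>

lemma exists_subset_card_between:
  fixes t :: real
  assumes "0 \<le> t" "t \<le> card A"
  shows "\<exists>B\<subseteq>A. t \<le> card B \<and> card B \<le> t + 1"
proof -
  have "nat \<lceil>t\<rceil> \<le> card A"
    using assms(2) by (simp add: nat_le_iff ceiling_le_iff)
  then obtain B where "B \<subseteq> A" "card B = nat \<lceil>t\<rceil>"
    by (rule obtain_subset_with_card_n)
  moreover have "t \<le> nat \<lceil>t\<rceil>" "nat \<lceil>t\<rceil> \<le> t + 1"
    using assms(1) by linarith+
  ultimately show ?thesis
    by auto
qed

lemma sum_card_Image_commute:
  assumes "finite S" "finite T"
  shows "(\<Sum>x\<in>S. card (R `` {x} \<inter> T)) = (\<Sum>y\<in>T. card (R\<inverse> `` {y} \<inter> S))"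
proof -
  have "R `` {x} \<inter> T = {y \<in> T. (x, y) \<in> R}" "R\<inverse> `` {y} \<inter> S = {x \<in> S. (x, y) \<in> R}" for x y
    by auto
  then show ?thesis
    using sum_multicount_gen[OF assms, of "\<lambda>x y. (x, y) \<in> R"] by simp
qed

lemma card_Int_Times_remove:
  assumes "finite R" "x \<in> X"
  shows "card (R \<inter> X \<times> Y) = card (R \<inter> (X - {x}) \<times> Y) + card (R `` {x} \<inter> Y)"
proof -
  have "R \<inter> X \<times> Y = (R \<inter> (X - {x}) \<times> Y) \<union> Pair x ` (R `` {x} \<inter> Y)"
    using assms(2) by auto
  then have "card (R \<inter> X \<times> Y) = card (R \<inter> (X - {x}) \<times> Y) + card (Pair x ` (R `` {x} \<inter> Y))"
    using assms(1) by (simp only:) (intro card_Un_disjoint; auto)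
  then show ?thesis
    by (simp add: card_image inj_on_def)
qed

lemma card_Int_Times_converse: "card (R\<inverse> \<inter> Y \<times> X) = card (R \<inter> X \<times> Y)"
proof -
  have "R\<inverse> \<inter> Y \<times> X = (R \<inter> X \<times> Y)\<inverse>"
    by auto
  then show ?thesis
    by (simp only: card_inverse)
qed

lemma exists_optimal_subset_pair:
  fixes F :: "'a set \<Rightarrow> 'b set \<Rightarrow> 'c::linorder"
  assumes "finite X" "finite Y"
  shows "\<exists>A\<subseteq>X. \<exists>B\<subseteq>Y. \<forall>A'\<subseteq>X. \<forall>B'\<subseteq>Y. F A' B' \<le> F A B"
proof -
  have fin: "finite (Pow X \<times> Pow Y)"
    using assms by simp
  obtain P where "P \<in> Pow X \<times> Pow Y" "Max (case_prod F ` (Pow X \<times> Pow Y)) = case_prod F P"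
    by (rule obtains_MAX[OF fin, of "case_prod F"]) auto
  moreover have "case_prod F (A, B) \<le> Max (case_prod F ` (Pow X \<times> Pow Y))" if "A \<subseteq> X" "B \<subseteq> Y" for A B
    using that fin by (intro Max_ge) auto
  ultimately show ?thesis
    by (intro exI[of _ "fst P"] exI[of _ "snd P"] conjI) (auto simp: case_prod_unfold)
qed

lemma exists_bipartite_core:
  fixes R :: "('a \<times> 'b) set" and l1 l2 :: real
  assumes fin: "finite X" "finite Y" and R: "R \<subseteq> X \<times> Y" and nonneg: "0 \<le> l1" "0 \<le> l2"
    and dense: "l1 * card X + l2 * card Y < card R"
  shows "\<exists>X' Y'. X' \<subseteq> X \<and> Y' \<subseteq> Y \<and> X' \<noteq> {} \<and> Y' \<noteq> {} \<and>
    (\<forall>x\<in>X'. l1 \<le> card (R `` {x} \<inter> Y')) \<and> (\<forall>y\<in>Y'. l2 \<le> card (R\<inverse> `` {y} \<inter> X'))"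
proof -
  define F where "F A B = real (card (R \<inter> A \<times> B)) - l1 * card A - l2 * card B" for A B
  have finR: "finite R"
    using fin R by (auto intro: finite_subset)
  obtain X' Y' where sub: "X' \<subseteq> X" "Y' \<subseteq> Y" and opt: "\<forall>A\<subseteq>X. \<forall>B\<subseteq>Y. F A B \<le> F X' Y'"
    using exists_optimal_subset_pair[OF fin, of F] by blast
  have fin': "finite X'" "finite Y'"
    using sub fin by (auto intro: finite_subset)
  have "0 < F X Y"
    using R dense by (simp add: F_def Int_absorb2)
  also have "\<dots> \<le> F X' Y'"
    using opt[rule_format, of X Y] by simp
  also have "\<dots> \<le> card (R \<inter> X' \<times> Y')"
    using mult_nonneg_nonneg[OF nonneg(1), of "card X'"] mult_nonneg_nonneg[OF nonneg(2), of "card Y'"]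
    by (simp add: F_def)
  finally have nonempty: "X' \<noteq> {}" "Y' \<noteq> {}"
    by auto
  have "l1 \<le> card (R `` {x} \<inter> Y')" if x: "x \<in> X'" for x
  proof -
    have "F (X' - {x}) Y' \<le> F X' Y'"
      using opt[rule_format, of "X' - {x}" Y'] sub by auto
    then show ?thesis
      using card_Int_Times_remove[OF finR x, of Y'] card.remove[OF fin'(1) x]
      by (simp add: F_def algebra_simps)
  qed
  moreover have "l2 \<le> card (R\<inverse> `` {y} \<inter> X')" if y: "y \<in> Y'" for y
  proof -
    have "F X' (Y' - {y}) \<le> F X' Y'"
      using opt[rule_format, of X' "Y' - {y}"] sub by auto
    then show ?thesis
      using card_Int_Times_remove[of "R\<inverse>", OF _ y, of X'] finR card.remove[OF fin'(2) y]
      by (simp add: F_def card_Int_Times_converse algebra_simps)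
  qed
  ultimately show ?thesis
    using sub nonempty by blast
qed

lemma exists_large_cut:
  fixes E :: "'a rel"
  assumes "finite V" "E \<subseteq> V \<times> V" "irrefl E"
  shows "\<exists>A\<subseteq>V. card E \<le> 4 * card (E \<inter> A \<times> (V - A))"
proof -
  let ?M = "random_subset (1 / 2) V" and ?cut = "\<lambda>A. {(x, y) \<in> E. x \<in> A \<and> y \<notin> A}"
  have fin: "finite (set_pmf ?M)" "finite E"
    using assms by (auto intro: finite_set_pmf_random_subset finite_subset)
  have "measure_pmf.expectation ?M (\<lambda>A. real (card (?cut A)))
      = (\<Sum>e\<in>E. measure_pmf.prob ?M {A. e \<in> ?cut A})"
    using fin by (intro expectation_card_pmf) auto
  also have "\<dots> = (\<Sum>e\<in>E. 1 / 4)"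
  proof (rule sum.cong[OF refl])
    fix e assume e: "e \<in> E"
    then show "measure_pmf.prob ?M {A. e \<in> ?cut A} = 1 / 4"
      using assms prob_random_subset_pair[of V "fst e" "snd e" "1 / 2" True False]
      by (cases e) (auto simp: irrefl_def)
  qed
  finally have "measure_pmf.expectation ?M (\<lambda>A. real (card (?cut A))) = card E / 4"
    by simp
  then obtain A where A: "A \<in> set_pmf ?M" "- real (card (?cut A)) \<le> - (card E / 4)"
    using exists_le_expectation[OF fin(1), of "\<lambda>A. - real (card (?cut A))"] by auto
  have "A \<subseteq> V"
    using A(1) set_pmf_random_subset by blast
  moreover have "?cut A = E \<inter> A \<times> (V - A)"
    using assms by auto
  ultimately show ?thesis
    using A(2) by auto
qed

lemma exists_bipartite_subgraph_min_degree:
  fixes E :: "'a rel" and l :: real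
  assumes fin: "finite V" and E: "E \<subseteq> V \<times> V" "sym E" "irrefl E"
    and l: "0 \<le> l" "4 * l * card V < card E"
  shows "\<exists>X Y. X \<subseteq> V \<and> Y \<subseteq> V \<and> X \<inter> Y = {} \<and> X \<noteq> {} \<and> Y \<noteq> {} \<and>
    (\<forall>x\<in>X. l \<le> card (E `` {x} \<inter> Y)) \<and> (\<forall>y\<in>Y. l \<le> card (E `` {y} \<inter> X))"
proof -
  obtain A where A: "A \<subseteq> V" "card E \<le> 4 * card (E \<inter> A \<times> (V - A))"
    using exists_large_cut[OF fin E(1,3)] by blast
  define R where "R = E \<inter> A \<times> (V - A)"
  have finA: "finite A" "finite (V - A)"
    using A(1) fin by (auto intro: finite_subset)
  have R_subset: "R \<subseteq> A \<times> (V - A)"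
    by (auto simp: R_def)
  have "real (card V) = card A + card (V - A)"
    using card_Int_Diff[OF fin, of A] A(1) by (simp add: Int_absorb1)
  then have dense: "l * card A + l * card (V - A) < card R"
    using l(2) A(2) by (simp add: R_def flip: distrib_left)
  obtain X Y where XY: "X \<subseteq> A" "Y \<subseteq> V - A" "X \<noteq> {}" "Y \<noteq> {}"
    and degX: "\<forall>x\<in>X. l \<le> card (R `` {x} \<inter> Y)" and degY: "\<forall>y\<in>Y. l \<le> card (R\<inverse> `` {y} \<inter> X)"
    using exists_bipartite_core[OF finA R_subset l(1,1) dense] by blast
  have finXY: "finite X" "finite Y"
    using XY(1,2) finA by (auto intro: finite_subset)
  have "l \<le> card (E `` {x} \<inter> Y)" if "x \<in> X" for x
  proof -
    have "card (R `` {x} \<inter> Y) \<le> card (E `` {x} \<inter> Y)"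
      using finXY by (intro card_mono) (auto simp: R_def)
    then show ?thesis
      using bspec[OF degX that] by linarith
  qed
  moreover have "l \<le> card (E `` {y} \<inter> X)" if "y \<in> Y" for y
  proof -
    have "card (R\<inverse> `` {y} \<inter> X) \<le> card (E `` {y} \<inter> X)"
      using finXY symD[OF E(2)] by (intro card_mono) (auto simp: R_def)
    then show ?thesis
      using bspec[OF degY that] by linarith
  qed
  moreover have "X \<subseteq> V" "Y \<subseteq> V" "X \<inter> Y = {}"
    using XY(1,2) A(1) by auto
  ultimately show ?thesis
    using XY(3,4) by blast
qed

definition star_packing :: "('b \<Rightarrow> 'a set) \<Rightarrow> nat \<Rightarrow> 'b set \<Rightarrow> ('b \<Rightarrow> 'a set) \<Rightarrow> bool" where
  "star_packing N a Z S \<longleftrightarrow> (\<forall>z\<in>Z. S z \<subseteq> N z \<and> card (S z) = a) \<and> disjoint_family_on S Z"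

lemma star_packing_mono:
  assumes "star_packing N a Z S" "\<And>z. N z \<subseteq> N' z"
  shows "star_packing N' a Z S"
  using assms unfolding star_packing_def by fast

lemma star_packing_insert:
  assumes "star_packing N a Z S" "y \<notin> Z" "T \<subseteq> N y - \<Union> (S ` Z)" "card T = a"
  shows "star_packing N a (insert y Z) (S(y := T))"
proof -
  have update: "(S(y := T)) y = T" "\<And>z. z \<in> Z \<Longrightarrow> (S(y := T)) z = S z"
    using assms(2) by auto
  have "disjoint_family_on (S(y := T)) (insert y Z)"
    using assms(1,3) update by (fastforce simp: star_packing_def disjoint_family_on_def)
  then show ?thesis
    using assms update by (auto simp: star_packing_def)
qed

lemma exists_maximal_star_packing:
  assumes "finite Y"
  shows "\<exists>Z\<subseteq>Y. \<exists>S. star_packing N a Z S \<and> (\<forall>y\<in>Y - Z. finite (N y) \<longrightarrow> card (N y - \<Union> (S ` Z)) < a)"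
proof -
  define \<Z> where "\<Z> = {Z. Z \<subseteq> Y \<and> (\<exists>S. star_packing N a Z S)}"
  have "finite \<Z>"
    using assms by (simp add: \<Z>_def)
  moreover have "{} \<in> \<Z>"
    by (auto simp: \<Z>_def star_packing_def disjoint_family_on_def)
  ultimately obtain Z where Z: "Z \<in> \<Z>" and maximal: "\<And>Z'. Z' \<in> \<Z> \<Longrightarrow> Z \<subseteq> Z' \<Longrightarrow> Z = Z'"
    using finite_has_maximal[of \<Z>] by auto
  obtain S where S: "star_packing N a Z S" "Z \<subseteq> Y"
    using Z by (auto simp: \<Z>_def)
  have "card (N y - \<Union> (S ` Z)) < a" if y: "y \<in> Y - Z" "finite (N y)" for y
  proof (rule ccontr)
    assume "\<not> ?thesis"
    then obtain T where "T \<subseteq> N y - \<Union> (S ` Z)" "card T = a"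
      by (meson not_less obtain_subset_with_card_n)
    then have "star_packing N a (insert y Z) (S(y := T))"
      using y by (intro star_packing_insert S(1)) auto
    then have "insert y Z \<in> \<Z>"
      using y S(2) by (auto simp: \<Z>_def)
    then show False
      using maximal[of "insert y Z"] y by auto
  qed
  then show ?thesis
    using S by blast
qed

lemma star_packing_card_leaves_le:
  assumes "star_packing N a Z S" "finite Z"
  shows "card (\<Union> (S ` Z)) \<le> a * card Z"
  using card_UN_le[OF assms(2), of S] assms(1) by (simp add: star_packing_def mult.commute)

lemma mult_card_le_of_degrees:
  assumes fin: "finite B" "finite W"
    and lower: "\<And>z. z \<in> B \<Longrightarrow> a \<le> card (R\<inverse> `` {z} \<inter> W)"
    and upper: "\<And>x. x \<in> W \<Longrightarrow> card (R `` {x} \<inter> B) \<le> d"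
  shows "a * card B \<le> d * card W"
proof -
  have "a * card B \<le> (\<Sum>z\<in>B. card (R\<inverse> `` {z} \<inter> W))"
    using sum_mono[of B "\<lambda>_. a", OF lower] by (simp add: mult.commute)
  also have "\<dots> = (\<Sum>x\<in>W. card (R `` {x} \<inter> B))"
    by (rule sum_card_Image_commute[OF fin(2,1), symmetric])
  also have "\<dots> \<le> d * card W"
    using sum_mono[of W _ "\<lambda>_. d", OF upper] by (simp add: mult.commute)
  finally show ?thesis .
qed

lemma exists_star_packing_half:
  assumes fin: "finite X" "finite Z" and pos: "0 < m" "0 < d"
    and degX: "\<And>x. x \<in> X \<Longrightarrow> card (R `` {x} \<inter> Z) \<le> d"
    and degZ: "\<And>z. z \<in> Z \<Longrightarrow> 2 * m * d \<le> card (R\<inverse> `` {z} \<inter> X)"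
  shows "\<exists>Z1\<subseteq>Z. \<exists>S. star_packing (\<lambda>z. R\<inverse> `` {z} \<inter> X) m Z1 S \<and> card Z \<le> 2 * card Z1"
proof -
  let ?N = "\<lambda>z. R\<inverse> `` {z} \<inter> X"
  obtain Z1 S where Z1: "Z1 \<subseteq> Z" and S: "star_packing ?N m Z1 S"
    and maximal: "\<And>z. z \<in> Z - Z1 \<Longrightarrow> card (?N z - \<Union> (S ` Z1)) < m"
    using exists_maximal_star_packing[OF fin(2), of ?N m] fin(1) by blast
  define W where "W = \<Union> (S ` Z1)"
  have finZ1: "finite Z1"
    using Z1 fin by (auto intro: finite_subset)
  have W_subset: "W \<subseteq> X"
    using S by (auto simp: W_def star_packing_def)
  have "(m * d) * card (Z - Z1) \<le> d * card W"
  proof (rule mult_card_le_of_degrees[where R=R])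
    show "finite (Z - Z1)" "finite W"
      using fin W_subset by (auto intro: finite_subset)
    fix z assume z: "z \<in> Z - Z1"
    have "?N z \<inter> W = R\<inverse> `` {z} \<inter> W"
      using W_subset by auto
    then have "2 * m * d \<le> card (R\<inverse> `` {z} \<inter> W) + card (?N z - W)"
      using degZ[of z] z card_Int_Diff[of "?N z" W] fin(1) by simp
    moreover have "card (?N z - W) < m"
      using maximal[OF z] by (simp add: W_def)
    moreover have "m \<le> m * d"
      using pos by simp
    ultimately show "m * d \<le> card (R\<inverse> `` {z} \<inter> W)"
      by (simp only: mult.assoc)
  next
    fix x assume "x \<in> W"
    have "card (R `` {x} \<inter> (Z - Z1)) \<le> card (R `` {x} \<inter> Z)"
      using fin(2) by (intro card_mono) auto
    also have "\<dots> \<le> d"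
      using \<open>x \<in> W\<close> W_subset by (intro degX) auto
    finally show "card (R `` {x} \<inter> (Z - Z1)) \<le> d" .
  qed
  also have "\<dots> \<le> (m * d) * card Z1"
    using star_packing_card_leaves_le[OF S finZ1] by (simp add: W_def mult_ac)
  finally have "card (Z - Z1) \<le> card Z1"
    using pos by simp
  moreover have "card Z = card Z1 + card (Z - Z1)"
    using card_Int_Diff[OF fin(2), of Z1] Z1 by (simp add: Int_absorb1)
  ultimately show ?thesis
    using Z1 S by (intro exI[of _ Z1]) auto
qed

lemma exists_exact_degree_subrelation:
  assumes "\<And>x. x \<in> X \<Longrightarrow> d \<le> card (E `` {x} \<inter> Z)"
  shows "\<exists>R\<subseteq>E \<inter> X \<times> Z. \<forall>x\<in>X. card (R `` {x}) = d"
proof -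
  have "\<forall>x\<in>X. \<exists>A. A \<subseteq> E `` {x} \<inter> Z \<and> card A = d"
    using assms by (meson obtain_subset_with_card_n)
  then obtain r where r: "\<And>x. x \<in> X \<Longrightarrow> r x \<subseteq> E `` {x} \<inter> Z" "\<And>x. x \<in> X \<Longrightarrow> card (r x) = d"
    by metis
  have "(SIGMA x:X. r x) \<subseteq> E \<inter> X \<times> Z"
    using r(1) by blast
  moreover have "(SIGMA x:X. r x) `` {x} = r x" if "x \<in> X" for x
    using that by auto
  ultimately show ?thesis
    using r(2) by (intro exI[of _ "SIGMA x:X. r x"]) simp
qed

lemma card_eq_of_exact_degree:
  assumes "finite X" "finite Z" "R \<subseteq> X \<times> Z" "\<And>x. x \<in> X \<Longrightarrow> card (R `` {x}) = d"
  shows "card R = card X * d"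
proof -
  have "finite (R `` {x})" for x
    using assms(2,3) by (auto intro: finite_subset[of _ Z])
  moreover have "R = (SIGMA x:X. R `` {x})"
    using assms(3) by auto
  ultimately have "card R = (\<Sum>x\<in>X. card (R `` {x}))"
    using assms(1) card_SigmaI[of X "\<lambda>x. R `` {x}"] by simp
  then show ?thesis
    using assms(4) by simp
qed

lemma exists_packed_core:
  fixes m d :: nat
  assumes fin: "finite X" "finite Z" and R: "R \<subseteq> X \<times> Z" and pos: "0 < m" "0 < d" "X \<noteq> {}"
    and degree: "\<And>x. x \<in> X \<Longrightarrow> card (R `` {x}) = d" and many: "5 * m * card Z \<le> card X"
  shows "\<exists>X'\<subseteq>X. \<exists>Z'\<subseteq>Z. Z' \<noteq> {} \<and> (\<forall>x\<in>X'. real d / 2 \<le> card (R `` {x} \<inter> Z')) \<and>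
    (\<exists>Z1\<subseteq>Z'. \<exists>S. star_packing (\<lambda>z. R\<inverse> `` {z} \<inter> X') m Z1 S \<and> card Z' \<le> 2 * card Z1)"
proof -
  have dense: "real d / 2 * card X + real (2 * m * d) * card Z < card R"
  proof -
    have "(2 / 5 * real d) * (5 * real m * card Z) \<le> (2 / 5 * real d) * card X"
      using of_nat_mono[OF many, where 'a=real] by (intro mult_left_mono) auto
    moreover have "0 < real d * card X"
      using fin(1) pos by (simp add: card_gt_0_iff)
    ultimately show ?thesis
      using card_eq_of_exact_degree[OF fin R degree] by (simp add: algebra_simps)
  qed
  have nonneg: "0 \<le> real d / 2" "0 \<le> real (2 * m * d)"
    by simp_all
  obtain X' Z' where core: "X' \<subseteq> X" "Z' \<subseteq> Z" "Z' \<noteq> {}" "\<forall>x\<in>X'. real d / 2 \<le> card (R `` {x} \<inter> Z')"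
    and degZ: "\<forall>z\<in>Z'. real (2 * m * d) \<le> card (R\<inverse> `` {z} \<inter> X')"
    using exists_bipartite_core[OF fin R nonneg dense] by blast
  have fin': "finite X'" "finite Z'"
    using core(1,2) fin by (auto intro: finite_subset)
  have "\<exists>Z1\<subseteq>Z'. \<exists>S. star_packing (\<lambda>z. R\<inverse> `` {z} \<inter> X') m Z1 S \<and> card Z' \<le> 2 * card Z1"
  proof (rule exists_star_packing_half[OF fin' pos(1,2)])
    fix x assume "x \<in> X'"
    have "card (R `` {x} \<inter> Z') \<le> card (R `` {x})"
      using R fin(2) by (intro card_mono) (auto intro: finite_subset[of _ Z])
    then show "card (R `` {x} \<inter> Z') \<le> d"
      using degree[of x] \<open>x \<in> X'\<close> core(1) by auto
  next
    fix z assume "z \<in> Z'"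
    then show "2 * m * d \<le> card (R\<inverse> `` {z} \<inter> X')"
      using bspec[OF degZ] by (simp only: of_nat_le_iff)
  qed
  then show ?thesis
    using core by blast
qed

lemma card_stars_losing_half_le:
  assumes S: "star_packing N (2 * a) Z S" and fin: "finite Z" "finite F" "\<And>z. z \<in> Z \<Longrightarrow> finite (N z)"
  shows "a * card {z \<in> Z. card (S z - F) < a} \<le> card F"
proof -
  let ?L = "{z \<in> Z. card (S z - F) < a}"
  have "a * card ?L \<le> (\<Sum>z\<in>?L. card (S z \<inter> F))"
  proof -
    have "a \<le> card (S z \<inter> F)" if "z \<in> ?L" for z
    proof -
      have "finite (S z)" "card (S z) = 2 * a"
        using S fin(3) that by (auto simp: star_packing_def intro: finite_subset)
      then show ?thesis
        using that card_Int_Diff[of "S z" F] by simp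
    qed
    then show ?thesis
      using sum_mono[of ?L "\<lambda>_. a"] by (simp add: mult.commute)
  qed
  also have "\<dots> = card (\<Union>z\<in>?L. S z \<inter> F)"
  proof (rule card_UN_disjoint[symmetric])
    show "\<forall>z\<in>?L. \<forall>w\<in>?L. z \<noteq> w \<longrightarrow> S z \<inter> F \<inter> (S w \<inter> F) = {}"
      using S unfolding star_packing_def disjoint_family_on_def by blast
  qed (use fin in auto)
  also have "\<dots> \<le> card F"
    using fin(2) by (intro card_mono) auto
  finally show ?thesis .
qed

subsection \<open>Contracting stars\<close>

lemma card_parcs_eq:
  assumes "pair_graph G"
  shows "card (parcs G) = 2 * card (edges G)"
proof -
  interpret pair_graph G by fact
  let ?f = "\<lambda>(u, v). {u, v}"
  have "card (parcs G) = (\<Sum>e\<in>?f ` parcs G. card {p \<in> parcs G. ?f p = e})"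
    using sum.image_gen[OF pair_finite_arcs, of "\<lambda>_. 1 :: nat" ?f] by simp
  also have "\<dots> = (\<Sum>e\<in>?f ` parcs G. 2)"
  proof (rule sum.cong[OF refl])
    fix e assume "e \<in> ?f ` parcs G"
    then obtain u v where e: "e = {u, v}" "(u, v) \<in> parcs G"
      by auto
    have "(v, u) \<in> parcs G" "u \<noteq> v"
      using arcs_symmetric[OF e(2)] pair_no_loops[OF e(2)] by simp_all
    then have "{p \<in> parcs G. ?f p = e} = {(u, v), (v, u)}"
      using e by (auto simp: doubleton_eq_iff)
    then show "card {p \<in> parcs G. ?f p = e} = 2"
      using \<open>u \<noteq> v\<close> by simp
  qed
  also have "?f ` parcs G = edges G"
    by (force simp: edges_def)
  finally show ?thesis
    by simp
qed

lemma average_degree_eq: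
  assumes "pair_graph G"
  shows "average_degree G = card (parcs G) / card (pverts G)"
  using card_parcs_eq[OF assms] by (simp add: average_degree_def)

definition induced_pair_graph :: "'a pair_pre_digraph \<Rightarrow> 'a set \<Rightarrow> 'a pair_pre_digraph" where
  "induced_pair_graph G S = \<lparr>pverts = S, parcs = parcs G \<inter> S \<times> S\<rparr>"

lemma (in pair_graph) pair_graph_induced:
  assumes "S \<subseteq> pverts G"
  shows "pair_graph (induced_pair_graph G S)"
proof unfold_locales
  show "finite (pverts (induced_pair_graph G S))"
    using finite_subset[OF assms pair_finite_verts] by (simp add: induced_pair_graph_def)
  show "symmetric (with_proj (induced_pair_graph G S))"
    by (auto simp: induced_pair_graph_def symmetric_def intro!: symI dest: arcs_symmetric)
qed (use pair_no_loops pair_finite_arcs in \<open>auto simp: induced_pair_graph_def\<close>)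

lemma (in pair_graph) subgraph_induced:
  assumes "S \<subseteq> pverts G"
  shows "subgraph (with_proj (induced_pair_graph G S)) (with_proj G)"
proof -
  interpret H: pair_graph "induced_pair_graph G S"
    using assms by (rule pair_graph_induced)
  show ?thesis
    using assms wf_digraph H.wf_digraph
    by (auto simp: subgraph_def compatible_def induced_pair_graph_def)
qed

lemma (in pair_graph) connected_star:
  assumes c: "c \<in> pverts G" and star: "\<And>v. v \<in> pverts G \<Longrightarrow> v \<noteq> c \<Longrightarrow> (c, v) \<in> parcs G"
  shows "Digraph_Component.connected (with_proj G)"
proof (rule connectedI)
  show "pverts G \<noteq> {}"
    using c by auto
  have reach: "c \<rightarrow>\<^sup>*\<^bsub>with_proj G\<^esub> v" "v \<rightarrow>\<^sup>*\<^bsub>with_proj G\<^esub> c" if "v \<in> pverts G" for v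
  proof -
    show "c \<rightarrow>\<^sup>*\<^bsub>with_proj G\<^esub> v"
      using c star[OF that] by (cases "v = c") auto
    show "v \<rightarrow>\<^sup>*\<^bsub>with_proj G\<^esub> c"
      using c arcs_symmetric[OF star[OF that]] by (cases "v = c") auto
  qed
  fix u v assume "u \<in> pverts G" "v \<in> pverts G"
  then have "u \<rightarrow>\<^sup>*\<^bsub>with_proj G\<^esub> v"
    using reach(2)[of u] reach(1)[of v] by (auto intro: reachable_trans)
  then show "u \<rightarrow>\<^sup>*\<^bsub>with_proj (mk_symmetric (with_proj G))\<^esub> v"
    by (rule reachable_mk_symmetricI)
qed

definition star_family :: "'a pair_pre_digraph \<Rightarrow> 'a set \<Rightarrow> ('a \<Rightarrow> 'a set) \<Rightarrow> bool" where
  "star_family G P b \<longleftrightarrow>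
     P \<subseteq> pverts G \<and> disjoint_family_on b P \<and> (\<forall>c\<in>P. c \<in> b c \<and> b c \<subseteq> insert c (parcs G `` {c}))"

definition contraction :: "'a pair_pre_digraph \<Rightarrow> 'a set \<Rightarrow> ('a \<Rightarrow> 'a set) \<Rightarrow> 'a pair_pre_digraph" where
  "contraction G P b =
     \<lparr>pverts = P, parcs = {(c, e). c \<in> P \<and> e \<in> P \<and> c \<noteq> e \<and> (\<exists>x\<in>b c. \<exists>y\<in>b e. (x, y) \<in> parcs G)}\<rparr>"

definition has_minor_of_degree :: "'a pair_pre_digraph \<Rightarrow> real \<Rightarrow> bool" where
  "has_minor_of_degree G \<delta> \<longleftrightarrow>
     (\<exists>\<Gamma> :: 'a pair_pre_digraph. pair_graph \<Gamma> \<and> pverts \<Gamma> \<noteq> {} \<and> is_minor \<Gamma> G \<and> \<delta> \<le> average_degree \<Gamma>)"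

lemma has_minor_of_degree_mono:
  "has_minor_of_degree G \<delta> \<Longrightarrow> \<epsilon> \<le> \<delta> \<Longrightarrow> has_minor_of_degree G \<epsilon>"
  unfolding has_minor_of_degree_def by (meson order_trans)

context pair_graph
begin

abbreviation nbrs :: "'a \<Rightarrow> 'a set" where
  "nbrs x \<equiv> parcs G `` {x}"

lemma pair_graph_contraction:
  assumes "finite P"
  shows "pair_graph (contraction G P b)"
proof unfold_locales
  show "finite (parcs (contraction G P b))"
    by (rule finite_subset[of _ "P \<times> P"]) (use assms in \<open>auto simp: contraction_def\<close>)
  show "symmetric (with_proj (contraction G P b))"
    by (auto simp: contraction_def symmetric_def intro!: symI dest: arcs_symmetric)
qed (use assms in \<open>auto simp: contraction_def\<close>)

lemma is_minor_contraction:
  assumes "star_family G P b"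
  shows "is_minor (contraction G P b) G"
proof -
  have sub: "b c \<subseteq> pverts G" if "c \<in> P" for c
    using assms that in_arcsD2 unfolding star_family_def by blast
  have "Digraph_Component.connected (with_proj (induced_pair_graph G (b c)))" if c: "c \<in> P" for c
  proof -
    interpret B: pair_graph "induced_pair_graph G (b c)"
      using sub[OF c] by (rule pair_graph_induced)
    show ?thesis
      using assms c by (intro B.connected_star[of c]) (auto simp: induced_pair_graph_def star_family_def)
  qed
  then show ?thesis
    unfolding is_minor_def using assms sub pair_graph_induced subgraph_induced
    by (intro exI[of _ "\<lambda>c. induced_pair_graph G (b c)"])
      (auto simp: contraction_def induced_pair_graph_def star_family_def disjoint_family_on_def)
qed

lemma has_minor_of_degree_star_family:
  fixes \<delta> :: real
  assumes b: "star_family G P b" and "P \<noteq> {}" "I \<subseteq> P"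
    and t: "\<And>i. i \<in> I \<Longrightarrow> t i \<subseteq> parcs (contraction G P b) `` {i}"
    and degree: "\<delta> * card P \<le> (\<Sum>i\<in>I. card (t i))"
  shows "has_minor_of_degree G \<delta>"
proof -
  have finP: "finite P"
    using b pair_finite_verts by (auto simp: star_family_def intro: finite_subset)
  interpret \<Gamma>: pair_graph "contraction G P b"
    by (rule pair_graph_contraction[OF finP])
  have "finite (t i)" if "i \<in> I" for i
    using t[OF that] by (rule finite_subset) simp
  then have "(\<Sum>i\<in>I. card (t i)) = card (SIGMA i:I. t i)"
    using finP assms(3) by (simp add: finite_subset)
  also have "\<dots> \<le> card (parcs (contraction G P b))"
    using t by (intro card_mono \<Gamma>.pair_finite_arcs) auto
  finally have "\<delta> * card P \<le> card (parcs (contraction G P b))"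
    using degree by linarith
  then have "\<delta> \<le> average_degree (contraction G P b)"
    using finP \<open>P \<noteq> {}\<close> unfolding average_degree_eq[OF \<Gamma>.pair_graph_axioms]
    by (simp add: contraction_def pos_le_divide_eq card_gt_0_iff)
  moreover have "pverts (contraction G P b) \<noteq> {}"
    using \<open>P \<noteq> {}\<close> by (simp add: contraction_def)
  ultimately show ?thesis
    unfolding has_minor_of_degree_def using \<Gamma>.pair_graph_axioms is_minor_contraction[OF b] by blast
qed

lemma has_minor_of_degree_self:
  assumes "pverts G \<noteq> {}"
  shows "has_minor_of_degree G (average_degree G)"
proof -
  have "contraction G (pverts G) (\<lambda>c. {c}) = G"
    using in_arcsD1 in_arcsD2 pair_no_loops by (cases G) (fastforce simp: contraction_def)
  moreover have "star_family G (pverts G) (\<lambda>c. {c})"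
    by (auto simp: star_family_def disjoint_family_on_def)
  ultimately show ?thesis
    unfolding has_minor_of_degree_def using assms pair_graph_axioms is_minor_contraction by (metis order_refl)
qed

lemma converse_parcs: "(parcs G)\<inverse> = parcs G"
  by (auto dest: arcs_symmetric)

lemma sum_degrees_commute:
  assumes "finite S" "finite T"
  shows "(\<Sum>x\<in>S. card (nbrs x \<inter> T)) = (\<Sum>y\<in>T. card (nbrs y \<inter> S))"
  using sum_card_Image_commute[OF assms, of "parcs G"] by (simp only: converse_parcs)

lemma star_family_packing:
  assumes S: "star_packing (\<lambda>z. nbrs z \<inter> X) a Z1 S"
    and "Z1 \<subseteq> Z" "Z \<subseteq> pverts G" "X \<inter> Z = {}"
  shows "star_family G Z (\<lambda>z. insert z (if z \<in> Z1 then S z else {}))"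
proof -
  have leaves: "S z \<subseteq> nbrs z \<inter> X" if "z \<in> Z1" for z
    using S that by (auto simp: star_packing_def)
  have "disjoint_family_on (\<lambda>z. insert z (if z \<in> Z1 then S z else {})) Z"
    unfolding disjoint_family_on_def
  proof (intro ballI impI)
    fix z w assume zw: "z \<in> Z" "w \<in> Z" "z \<noteq> w"
    have "S z \<inter> S w = {}" if "z \<in> Z1" "w \<in> Z1"
      using S zw that by (auto simp: star_packing_def disjoint_family_on_def)
    moreover have "z \<notin> X" "w \<notin> X"
      using zw assms(4) by auto
    ultimately show "insert z (if z \<in> Z1 then S z else {}) \<inter> insert w (if w \<in> Z1 then S w else {}) = {}"
      using zw(3) leaves[of z] leaves[of w] by auto
  qed
  then show ?thesis
    using assms(3) leaves by (auto simp: star_family_def)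
qed

lemma star_family_grouping:
  assumes sub: "X \<subseteq> pverts G" "I \<subseteq> pverts G" "C \<subseteq> X"
    and disj: "I \<inter> X = {}" "H \<inter> X = {}" "H \<inter> I = {}" "disjoint_family_on L I"
    and L: "\<And>i. i \<in> I \<Longrightarrow> L i \<subseteq> nbrs i \<inter> X"
    and g: "\<And>y. y \<in> H \<Longrightarrow> g y \<in> nbrs y \<inter> C"
    and bI: "\<And>i. i \<in> I \<Longrightarrow> b i = insert i (L i - C)"
    and bC: "\<And>c. c \<in> C \<Longrightarrow> b c = insert c {y \<in> H. g y = c}"
  shows "star_family G (I \<union> C) b"
  unfolding star_family_def
proof (intro conjI ballI)
  show "I \<union> C \<subseteq> pverts G"
    using sub by auto
  have stars: "b c \<inter> b e = {}" if "c \<in> I" "e \<in> I" "c \<noteq> e" for c e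
  proof -
    have "L c \<inter> L e = {}"
      using disj(4) that by (rule disjoint_family_onD)
    moreover have "c \<notin> L e" "e \<notin> L c"
      using L[OF that(1)] L[OF that(2)] that disj(1) by auto
    ultimately show ?thesis
      using that by (auto simp: bI)
  qed
  have star_group: "b c \<inter> b e = {}" if "c \<in> I" "e \<in> C" for c e
    using L[OF that(1)] that sub(3) disj by (auto simp: bI bC)
  have groups: "b c \<inter> b e = {}" if "c \<in> C" "e \<in> C" "c \<noteq> e" for c e
    using that sub(3) disj(2) by (auto simp: bC)
  show "disjoint_family_on b (I \<union> C)"
    unfolding disjoint_family_on_def using stars star_group groups by (metis Int_commute Un_iff)
  fix c assume "c \<in> I \<union> C"
  then show "c \<in> b c"
    using bI bC by auto
  show "b c \<subseteq> insert c (nbrs c)"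
  proof (cases "c \<in> I")
    case True
    then show ?thesis
      using L[OF True] by (auto simp: bI)
  next
    case False
    then have "b c = insert c {y \<in> H. g y = c}"
      using \<open>c \<in> I \<union> C\<close> bC by auto
    moreover have "y \<in> nbrs c" if "y \<in> H" "g y = c" for y
      using g[OF that(1)] that(2) arcs_symmetric[of y c] by auto
    ultimately show ?thesis
      by auto
  qed
qed

lemma minor_of_grouping:
  fixes \<delta> :: real
  assumes sub: "X \<subseteq> pverts G" "I \<subseteq> pverts G" "C \<subseteq> X"
    and disj: "I \<inter> X = {}" "H \<inter> X = {}" "H \<inter> I = {}" "disjoint_family_on L I" "I \<noteq> {}"
    and L: "\<And>i. i \<in> I \<Longrightarrow> L i \<subseteq> nbrs i \<inter> X"
    and g: "\<And>y. y \<in> H \<Longrightarrow> g y \<in> nbrs y \<inter> C"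
    and link: "\<And>i y. i \<in> I \<Longrightarrow> y \<in> T i \<Longrightarrow> \<xi> i y \<in> nbrs y \<inter> L i"
    and degree: "\<delta> * card (I \<union> C) \<le> (\<Sum>i\<in>I. card (g ` {y \<in> T i \<inter> H. \<xi> i y \<notin> C}))"
  shows "has_minor_of_degree G \<delta>"
proof -
  define b where "b c = insert c (if c \<in> I then L c - C else {y \<in> H. g y = c})" for c
  have I_disjoint_C: "I \<inter> C = {}"
    using disj(1) sub(3) by auto
  have bI: "b i = insert i (L i - C)" if "i \<in> I" for i
    using that by (simp add: b_def)
  have bC: "b c = insert c {y \<in> H. g y = c}" if "c \<in> C" for c
    using that I_disjoint_C by (auto simp: b_def)
  have family: "star_family G (I \<union> C) b"
    using sub disj(1-4) L g bI bC by (rule star_family_grouping)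
  have arcs: "g ` {y \<in> T i \<inter> H. \<xi> i y \<notin> C} \<subseteq> parcs (contraction G (I \<union> C) b) `` {i}" if i: "i \<in> I" for i
  proof
    fix c assume "c \<in> g ` {y \<in> T i \<inter> H. \<xi> i y \<notin> C}"
    then obtain y where y: "c = g y" "y \<in> T i" "y \<in> H" "\<xi> i y \<notin> C"
      by auto
    have "c \<in> C"
      using g[OF y(3)] y(1) by simp
    moreover have "\<xi> i y \<in> b i"
      using link[OF i y(2)] y(4) by (simp add: bI[OF i])
    moreover have "y \<in> b c"
      using y(1,3) unfolding bC[OF \<open>c \<in> C\<close>] by simp
    moreover have "(\<xi> i y, y) \<in> parcs G"
      using link[OF i y(2)] arcs_symmetric[of y "\<xi> i y"] by simp
    moreover have "i \<noteq> c"
      using i I_disjoint_C \<open>c \<in> C\<close> by auto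
    ultimately show "c \<in> parcs (contraction G (I \<union> C) b) `` {i}"
      using i unfolding contraction_def by auto
  qed
  show ?thesis
    by (rule has_minor_of_degree_star_family[OF family _ _ arcs degree]) (use disj(5) in auto)
qed

end

subsection \<open>Graphs of bounded codegree\<close>

locale bounded_codegree_graph = pair_graph G for G :: "'a pair_pre_digraph" +
  fixes s k :: nat
  assumes two_le_s: "2 \<le> s" and k_pos: "1 \<le> k"
    and codegree: "codegree_bounded s k nbrs (pverts G) (pverts G)"
begin

lemma finite_verts_subset: "X \<subseteq> pverts G \<Longrightarrow> finite X"
  using pair_finite_verts by (rule finite_subset[rotated])

lemma card_adjacent_ge:
  fixes d :: real
  assumes "S \<subseteq> pverts G" "T \<subseteq> pverts G" and degree: "\<And>x. x \<in> S \<Longrightarrow> d \<le> card (nbrs x \<inter> T)"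
    and small: "2 * real s ^ s * k * real (card S) ^ (s - 1) \<le> d"
  shows "card S * d \<le> 2 * s * card {y \<in> T. nbrs y \<inter> S \<noteq> {}}"
proof (rule card_nbrs_ge[OF _ _ _ _ _ small])
  show fin: "finite S" "finite T"
    using assms(1,2) by (simp_all add: finite_verts_subset)
  show "codegree_bounded s k nbrs S T"
    using codegree assms(1,2) pair_finite_verts by (rule codegree_bounded_subset)
  have "card S * d \<le> (\<Sum>x\<in>S. real (card (nbrs x \<inter> T)))"
    using sum_mono[of S "\<lambda>_. d", OF degree] by simp
  also have "\<dots> = (\<Sum>y\<in>T. real (card (nbrs y \<inter> S)))"
    using sum_degrees_commute[OF fin] by (simp flip: of_nat_sum)
  finally show "card S * d \<le> (\<Sum>y\<in>T. real (card (nbrs y \<inter> S)))" .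
qed (use two_le_s in simp)

end

text \<open>The base is \<open>40 * 2560\<close>: target sets have at most \<open>40 * m * d\<close> elements, and the sums of inverse
  degrees are split at \<open>1 / (2560 * m)\<close>.\<close>

definition degree_threshold :: "nat \<Rightarrow> nat \<Rightarrow> nat" where
  "degree_threshold s k = 102400 ^ (s - 1) * s ^ s * k"

locale contraction_scale = bounded_codegree_graph +
  fixes m d :: nat
  assumes m_pos: "0 < m" and threshold_le: "degree_threshold s k * m ^ (2 * (s - 1)) \<le> d"
begin

lemma degree_ge: "2560 * m * s \<le> d"
proof -
  have "(102400::nat) \<le> 102400 ^ (s - 1)"
    using two_le_s by (intro self_le_power) auto
  then have "(2560::nat) \<le> 102400 ^ (s - 1)"
    by (rule order_trans[rotated]) simp
  moreover have "s \<le> s ^ s" "m \<le> m ^ (2 * (s - 1))"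
    using two_le_s m_pos by (intro self_le_power; simp)+
  ultimately have "2560 * s * 1 * m \<le> 102400 ^ (s - 1) * s ^ s * k * m ^ (2 * (s - 1))"
    using k_pos by (intro mult_le_mono)
  also have "\<dots> \<le> d"
    using threshold_le by (simp only: degree_threshold_def)
  finally show ?thesis
    by (simp add: mult_ac)
qed

lemma degree_pos: "0 < d"
proof -
  have "0 < 2560 * m * s"
    using two_le_s m_pos by simp
  then show ?thesis
    using degree_ge by linarith
qed

lemma neighbourhood_small: "4 * real s ^ s * k * real (40 * m) ^ (s - 1) \<le> d"
proof -
  have "(4::nat) \<le> 4 ^ (s - 1)"
    using two_le_s by (intro self_le_power) auto
  then have "4 * s ^ s * k * (40 * m) ^ (s - 1) \<le> 4 ^ (s - 1) * s ^ s * k * (40 * m) ^ (s - 1)"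
    by (intro mult_le_mono1)
  also have "\<dots> = (4 ^ (s - 1) * 40 ^ (s - 1)) * m ^ (s - 1) * (s ^ s * k)"
    by (simp only: power_mult_distrib mult_ac)
  also have "(4::nat) ^ (s - 1) * 40 ^ (s - 1) = 160 ^ (s - 1)"
    by (simp flip: power_mult_distrib)
  also have "160 ^ (s - 1) * m ^ (s - 1) * (s ^ s * k) \<le> 102400 ^ (s - 1) * m ^ (2 * (s - 1)) * (s ^ s * k)"
    using m_pos by (intro mult_le_mono power_mono power_increasing) simp_all
  also have "\<dots> \<le> d"
    using threshold_le by (simp only: degree_threshold_def mult_ac)
  finally have "real (4 * s ^ s * k * (40 * m) ^ (s - 1)) \<le> real d"
    by (rule of_nat_mono)
  then show ?thesis
    by simp
qed

lemma overlap_small: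
  "real s ^ s * k * (40 * real m * d) ^ (s - 1) \<le> (1 / (2560 * real m)) ^ (s - 1) * real d ^ s"
proof -
  have "real s ^ s * k * (40 * real m * d) ^ (s - 1) * (2560 * real m) ^ (s - 1)
      = real s ^ s * k * ((40 * real m * d) * (2560 * real m)) ^ (s - 1)"
    by (simp only: power_mult_distrib mult_ac)
  also have "(40 * real m * d) * (2560 * real m) = 102400 * real m ^ 2 * d"
    by (simp add: power2_eq_square)
  also have "real s ^ s * k * (102400 * real m ^ 2 * d) ^ (s - 1)
      = real (degree_threshold s k * m ^ (2 * (s - 1))) * real d ^ (s - 1)"
    by (simp add: degree_threshold_def power_mult_distrib power_mult mult_ac)
  also have "\<dots> \<le> real d * real d ^ (s - 1)"
    using threshold_le by (intro mult_right_mono of_nat_mono) auto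
  also have "\<dots> = real d ^ s"
    using two_le_s by (cases s) auto
  finally show ?thesis
    using m_pos unfolding power_one_over by (subst mult.commute) (simp add: pos_le_divide_eq)
qed

lemma card_adjacent_leaves_ge:
  assumes sub: "S \<subseteq> pverts G" "Z \<subseteq> pverts G" and S: "card S = m"
    and degree: "\<And>x. x \<in> S \<Longrightarrow> real d / 2 \<le> card (nbrs x \<inter> Z)"
  shows "real m * d / (8 * s) \<le> card ({y \<in> Z. nbrs y \<inter> S \<noteq> {}} - {z})"
proof -
  let ?A = "{y \<in> Z. nbrs y \<inter> S \<noteq> {}}"
  have "real m ^ (s - 1) \<le> real (40 * m) ^ (s - 1)"
    by (intro power_mono) auto
  then have "2 * (2 * real s ^ s * k * real (card S) ^ (s - 1)) \<le> 4 * real s ^ s * k * real (40 * m) ^ (s - 1)"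
    using S by (simp add: mult_left_mono)
  also note neighbourhood_small
  finally have "card S * (real d / 2) \<le> 2 * s * card ?A"
    using sub degree by (intro card_adjacent_ge) auto
  then have "real m * d / (4 * s) \<le> card ?A"
    using S two_le_s by (simp add: field_simps)
  moreover have "card ?A \<le> card (?A - {z}) + 1"
    using diff_card_le_card_Diff[of "{z}" ?A] by simp
  moreover have "1 \<le> real m * d / (8 * s)"
  proof -
    have "8 * s \<le> 2560 * m * s * m"
      using m_pos by simp
    also have "\<dots> \<le> d * m"
      using degree_ge by (rule mult_le_mono1)
    finally have "real (8 * s) \<le> real (d * m)"
      by (rule of_nat_mono)
    then show ?thesis
      using two_le_s by (simp add: field_simps)
  qed
  ultimately show ?thesis
    by (simp add: field_simps)
qed

lemma minor_of_half_packing: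
  assumes sub: "X \<subseteq> pverts G" "Z \<subseteq> pverts G" "X \<inter> Z = {}" "Z \<noteq> {}"
    and degree: "\<And>x. x \<in> X \<Longrightarrow> real d / 2 \<le> card (nbrs x \<inter> Z)"
    and packing: "star_packing (\<lambda>z. nbrs z \<inter> X) m Z1 S" and half: "Z1 \<subseteq> Z" "card Z \<le> 2 * card Z1"
  shows "has_minor_of_degree G (real m * d / (16 * s))"
proof (rule has_minor_of_degree_star_family)
  let ?b = "\<lambda>z. insert z (if z \<in> Z1 then S z else {})"
  let ?T = "\<lambda>z. {y \<in> Z. nbrs y \<inter> S z \<noteq> {}} - {z}"
  show "star_family G Z ?b"
    using packing half(1) sub(2,3) by (rule star_family_packing)
  show "?T z \<subseteq> parcs (contraction G Z ?b) `` {z}" if "z \<in> Z1" for z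
  proof
    fix y assume "y \<in> ?T z"
    then obtain x where "y \<in> Z" "y \<noteq> z" "x \<in> S z" "x \<in> nbrs y"
      by auto
    then show "y \<in> parcs (contraction G Z ?b) `` {z}"
      using that half(1) arcs_symmetric[of y x] by (auto simp: contraction_def)
  qed
  have "real m * d / (16 * s) * card Z \<le> real m * d / (16 * s) * (2 * card Z1)"
    using half(2) by (intro mult_left_mono) auto
  also have "\<dots> = (\<Sum>z\<in>Z1. real m * d / (8 * s))"
    by simp
  also have "\<dots> \<le> (\<Sum>z\<in>Z1. real (card (?T z)))"
  proof (intro sum_mono card_adjacent_leaves_ge sub(2))
    fix z assume "z \<in> Z1"
    then have S: "S z \<subseteq> nbrs z \<inter> X" "card (S z) = m"
      using packing by (auto simp: star_packing_def)
    then show "S z \<subseteq> pverts G" "card (S z) = m"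
      using sub(1) by auto
    show "real d / 2 \<le> card (nbrs x \<inter> Z)" if "x \<in> S z" for x
      using S(1) that by (intro degree) auto
  qed
  finally show "real m * d / (16 * s) * card Z \<le> (\<Sum>z\<in>Z1. card (?T z))"
    by simp
qed (fact sub(4) half(1))+

lemma minor_of_few_centres:
  assumes sub: "X \<subseteq> pverts G" "Z \<subseteq> pverts G" "X \<inter> Z = {}" "Z \<noteq> {}"
    and degree: "\<And>x. x \<in> X \<Longrightarrow> d \<le> card (nbrs x \<inter> Z)" and many: "5 * m * card Z \<le> card X"
  shows "has_minor_of_degree G (real m * d / (16 * s))"
proof -
  have fin: "finite X" "finite Z"
    using sub by (simp_all add: finite_verts_subset)
  have "X \<noteq> {}"
    using many m_pos sub(4) fin by (auto simp: card_gt_0_iff)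
  obtain R where R: "R \<subseteq> parcs G \<inter> X \<times> Z" "\<forall>x\<in>X. card (R `` {x}) = d"
    using exists_exact_degree_subrelation[of X d "parcs G" Z] degree by blast
  have R_subset: "R \<subseteq> X \<times> Z"
    using R(1) by auto
  obtain X' Z' Z1 S where core: "X' \<subseteq> X" "Z' \<subseteq> Z" "Z' \<noteq> {}"
    and degX: "\<forall>x\<in>X'. real d / 2 \<le> card (R `` {x} \<inter> Z')"
    and Z1: "Z1 \<subseteq> Z'" "card Z' \<le> 2 * card Z1" and S: "star_packing (\<lambda>z. R\<inverse> `` {z} \<inter> X') m Z1 S"
    using exists_packed_core[OF fin R_subset m_pos degree_pos \<open>X \<noteq> {}\<close> R(2)[rule_format] many] by blast
  have "R\<inverse> `` {z} \<inter> X' \<subseteq> nbrs z \<inter> X'" for z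
    using R(1) by (auto dest: arcs_symmetric)
  then have packing: "star_packing (\<lambda>z. nbrs z \<inter> X') m Z1 S"
    by (rule star_packing_mono[OF S])
  have "real d / 2 \<le> card (nbrs x \<inter> Z')" if "x \<in> X'" for x
  proof -
    have "card (R `` {x} \<inter> Z') \<le> card (nbrs x \<inter> Z')"
      using R(1) finite_subset[OF core(2) fin(2)] by (intro card_mono) auto
    then show ?thesis
      using degX that by fastforce
  qed
  then show ?thesis
    using core sub Z1 packing by (intro minor_of_half_packing[of X' Z' Z1 S]) auto
qed

lemma exists_targets:
  assumes sub: "L \<subseteq> pverts G" "Y \<subseteq> pverts G" and L: "20 * m \<le> card L" "card L \<le> 40 * m"
    and degree: "\<And>x. x \<in> L \<Longrightarrow> d \<le> card (nbrs x \<inter> Y)"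
  shows "\<exists>T\<subseteq>{y \<in> Y. nbrs y \<inter> L \<noteq> {}}. 10 * real m * d / s \<le> card T \<and> card T \<le> 40 * m * d"
proof -
  have "real (card L) ^ (s - 1) \<le> real (40 * m) ^ (s - 1)"
    using L(2) by (intro power_mono) auto
  then have "2 * (real s ^ s * k * real (card L) ^ (s - 1)) \<le> 2 * (real s ^ s * k * real (40 * m) ^ (s - 1))"
    by (intro mult_left_mono) auto
  also have "\<dots> \<le> 4 * real s ^ s * k * real (40 * m) ^ (s - 1)"
    by simp
  also note neighbourhood_small
  finally have "card L * real d \<le> 2 * s * card {y \<in> Y. nbrs y \<inter> L \<noteq> {}}"
    using sub degree by (intro card_adjacent_ge) (auto simp: mult.assoc)
  moreover have "real (20 * m) * d \<le> card L * real d"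
    using L(1) by (intro mult_right_mono of_nat_mono) auto
  ultimately have "10 * real m * d / s \<le> card {y \<in> Y. nbrs y \<inter> L \<noteq> {}}"
    using two_le_s by (simp add: field_simps)
  then obtain T where T: "T \<subseteq> {y \<in> Y. nbrs y \<inter> L \<noteq> {}}"
    "10 * real m * d / s \<le> card T" "card T \<le> 10 * real m * d / s + 1"
    using exists_subset_card_between[of "10 * real m * d / s" "{y \<in> Y. nbrs y \<inter> L \<noteq> {}}"] by auto
  have "10 * real m * d / s \<le> 10 * real m * d / 1"
    using two_le_s by (intro divide_left_mono) auto
  moreover have "real 1 \<le> real (m * d)"
    using m_pos degree_pos by (intro of_nat_mono) (simp add: Suc_le_eq)
  ultimately have "real (card T) \<le> real (40 * m * d)"
    using T(3) by (simp add: mult.commute)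
  then have "card T \<le> 40 * m * d"
    by (simp only: of_nat_le_iff)
  then show ?thesis
    using T(1,2) by blast
qed

lemma exists_linked_targets:
  assumes sub: "X \<subseteq> pverts G" "Y \<subseteq> pverts G"
    and L: "\<And>i. i \<in> I \<Longrightarrow> L i \<subseteq> X" "\<And>i. i \<in> I \<Longrightarrow> 20 * m \<le> card (L i) \<and> card (L i) \<le> 40 * m"
    and degL: "\<And>i x. i \<in> I \<Longrightarrow> x \<in> L i \<Longrightarrow> d \<le> card (nbrs x \<inter> Y)"
  shows "\<exists>T \<xi>. \<forall>i\<in>I. T i \<subseteq> Y \<and> 10 * real m * d / s \<le> card (T i) \<and> card (T i) \<le> 40 * m * d \<and>
    (\<forall>y\<in>T i. \<xi> i y \<in> nbrs y \<inter> L i)"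
proof -
  have "\<forall>i\<in>I. \<exists>T\<subseteq>{y \<in> Y. nbrs y \<inter> L i \<noteq> {}}. 10 * real m * d / s \<le> card T \<and> card T \<le> 40 * m * d"
  proof
    fix i assume i: "i \<in> I"
    then have "L i \<subseteq> pverts G"
      using L(1)[OF i] sub(1) by simp
    then show "\<exists>T\<subseteq>{y \<in> Y. nbrs y \<inter> L i \<noteq> {}}. 10 * real m * d / s \<le> card T \<and> card T \<le> 40 * m * d"
      using L(2)[OF i] degL[OF i] by (intro exists_targets sub(2)) simp_all
  qed
  from bchoice[OF this] obtain T where T: "\<forall>i\<in>I. T i \<subseteq> {y \<in> Y. nbrs y \<inter> L i \<noteq> {}} \<and>
      10 * real m * d / s \<le> card (T i) \<and> card (T i) \<le> 40 * m * d" ..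
  define \<xi> where "\<xi> i y = (SOME x. x \<in> nbrs y \<inter> L i)" for i y
  have "\<xi> i y \<in> nbrs y \<inter> L i" if "i \<in> I" "y \<in> T i" for i y
    unfolding \<xi>_def using bspec[OF T that(1)] that(2) by (intro someI_ex[of "\<lambda>x. x \<in> nbrs y \<inter> L i"]) auto
  then show ?thesis
    using T by (intro exI[of _ T] exI[of _ \<xi>]) auto
qed

lemma overlap_targets_le:
  assumes sub: "X \<subseteq> pverts G" "T \<subseteq> pverts G" and T: "card T \<le> 40 * m * d"
    and degree: "\<And>y. y \<in> T \<Longrightarrow> d \<le> card (nbrs y \<inter> X)"
  shows "overlap (\<lambda>y. nbrs y \<inter> X) UNIV T \<le> 2 * (1 / (2560 * real m)) * card T"
proof (rule overlap_le_of_codegree_bounded)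
  show fin: "finite X" "finite T"
    using sub by (simp_all add: finite_verts_subset)
  show "nbrs y \<inter> X \<subseteq> X" "real d \<le> card (nbrs y \<inter> X)" if "y \<in> T" for y
    using degree[OF that] by simp_all
  have "codegree_bounded s k nbrs T X"
    using codegree sub(2,1) pair_finite_verts by (rule codegree_bounded_subset)
  moreover have "{e \<in> X. A \<subseteq> {y. e \<in> nbrs y \<inter> X}} = {e \<in> X. A \<subseteq> nbrs e}" for A
    by (auto dest: arcs_symmetric)
  ultimately show "codegree_bounded s k (\<lambda>e. {y. e \<in> nbrs y \<inter> X}) T X"
    by (simp add: codegree_bounded_def)
  have "real (2560 * m * s) \<le> real d"
    using degree_ge by (rule of_nat_mono)
  then show "real s \<le> 1 / (2560 * real m) * real d"
    using m_pos by (simp add: field_simps)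
  have "real (card T) ^ (s - 1) \<le> (40 * real m * d) ^ (s - 1)"
    using of_nat_mono[OF T, where 'a=real] by (intro power_mono) auto
  then have "real s ^ s * k * real (card T) ^ (s - 1) \<le> real s ^ s * k * (40 * real m * d) ^ (s - 1)"
    by (intro mult_left_mono) auto
  then show "real s ^ s * k * real (card T) ^ (s - 1) \<le> (1 / (2560 * real m)) ^ (s - 1) * real d ^ s"
    using overlap_small by (rule order_trans)
qed (use two_le_s m_pos degree_pos in auto)

lemma set_grouping_targets:
  assumes sub: "X \<subseteq> pverts G" "Y \<subseteq> pverts G" "I \<subseteq> pverts G" "I \<noteq> {}"
    and T: "\<And>i. i \<in> I \<Longrightarrow> T i \<subseteq> Y" "\<And>i. i \<in> I \<Longrightarrow> T i \<noteq> {}" "\<And>i. i \<in> I \<Longrightarrow> card (T i) \<le> 40 * m * d"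
    and link: "\<And>i y. i \<in> I \<Longrightarrow> y \<in> T i \<Longrightarrow> \<xi> i y \<in> X"
    and degY: "\<And>y. y \<in> Y \<Longrightarrow> d \<le> card (nbrs y \<inter> X)"
  shows "set_grouping X I T (\<lambda>y. nbrs y \<inter> X) \<xi> (1 / (40 * real m)) (real d)"
proof
  have T_verts: "T i \<subseteq> pverts G" if "i \<in> I" for i
    using T(1)[OF that] sub(2) by simp
  show "finite X" "finite I"
    using sub by (simp_all add: finite_verts_subset)
  show finT: "finite (T i)" if "i \<in> I" for i
    using T_verts[OF that] by (rule finite_verts_subset)
  show "real d \<le> card (nbrs y \<inter> X)" if "i \<in> I" "y \<in> T i" for i y
    using degY[of y] T(1)[OF that(1)] that(2) by auto
  have "2560 * m * 1 \<le> 2560 * m * s"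
    using two_le_s by (intro mult_le_mono2) simp
  then have "real (2560 * m) \<le> real d"
    using degree_ge by (intro of_nat_mono) linarith
  then show "64 \<le> 1 / (40 * real m) * real d"
    using m_pos by (simp add: field_simps)
  show "0 < (\<Sum>i\<in>I. card (T i))"
    using \<open>finite I\<close> sub(4) T(2) finT by (intro sum_pos) (simp_all add: card_gt_0_iff)
  have "overlap (\<lambda>y. nbrs y \<inter> X) UNIV (T i) \<le> 2 * (1 / (2560 * real m)) * card (T i)" if "i \<in> I" for i
  proof (rule overlap_targets_le[OF sub(1) T_verts[OF that] T(3)[OF that]])
    show "d \<le> card (nbrs y \<inter> X)" if "y \<in> T i" for y
      using degY[of y] T(1)[OF \<open>i \<in> I\<close>] that by auto
  qed
  then have "(\<Sum>i\<in>I. overlap (\<lambda>y. nbrs y \<inter> X) UNIV (T i)) \<le> (\<Sum>i\<in>I. 2 * (1 / (2560 * real m)) * card (T i))"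
    by (rule sum_mono)
  then show "(\<Sum>i\<in>I. overlap (\<lambda>y. nbrs y \<inter> X) UNIV (T i))
      \<le> 1 / (40 * real m) / 32 * real (\<Sum>i\<in>I. card (T i))"
    by (simp add: sum_distrib_left)
qed (use link m_pos in \<open>auto simp: divide_le_eq\<close>)

lemma degree_of_grouping_le:
  assumes cardX: "card X \<le> 120 * m * card I" and C: "real (card C) \<le> 4 * (1 / (40 * real m)) * card X"
    and T: "\<And>i. i \<in> I \<Longrightarrow> 10 * real m * d / s \<le> card (T i)"
  shows "real m * d / (16 * s) * card (I \<union> C) \<le> real (\<Sum>i\<in>I. card (T i)) / 2"
proof -
  have "card X / real m \<le> 120 * card I"
    using of_nat_mono[OF cardX, where 'a=real] m_pos by (simp add: field_simps)
  then have "real (card (I \<union> C)) \<le> 13 * card I"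
    using C card_Un_le[of I C] by simp
  then have "real m * d / (16 * s) * card (I \<union> C) \<le> real m * d / (16 * s) * (13 * card I)"
    by (intro mult_left_mono) auto
  also have "\<dots> = 13 / 16 * (card I * (real m * d / s))"
    by simp
  also have "\<dots> \<le> 5 * (card I * (real m * d / s))"
    by (intro mult_right_mono) auto
  also have "\<dots> = (\<Sum>i\<in>I. 10 * real m * d / s) / 2"
    by simp
  also have "\<dots> \<le> real (\<Sum>i\<in>I. card (T i)) / 2"
    unfolding of_nat_sum using T by (intro divide_right_mono sum_mono) auto
  finally show ?thesis .
qed

lemma minor_of_many_stars:
  assumes sub: "X \<subseteq> pverts G" "Y \<subseteq> pverts G" "I \<subseteq> pverts G"
    and disj: "I \<inter> X = {}" "Y \<inter> X = {}" "Y \<inter> I = {}" "disjoint_family_on L I" "I \<noteq> {}"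
    and L: "\<And>i. i \<in> I \<Longrightarrow> L i \<subseteq> nbrs i \<inter> X" "\<And>i. i \<in> I \<Longrightarrow> 20 * m \<le> card (L i) \<and> card (L i) \<le> 40 * m"
    and degL: "\<And>i x. i \<in> I \<Longrightarrow> x \<in> L i \<Longrightarrow> d \<le> card (nbrs x \<inter> Y)"
    and degY: "\<And>y. y \<in> Y \<Longrightarrow> d \<le> card (nbrs y \<inter> X)"
    and cardX: "card X \<le> 120 * m * card I"
  shows "has_minor_of_degree G (real m * d / (16 * s))"
proof -
  have L_subset: "L i \<subseteq> X" if "i \<in> I" for i
    using L(1)[OF that] by simp
  have "\<exists>T \<xi>. \<forall>i\<in>I. T i \<subseteq> Y \<and> 10 * real m * d / s \<le> card (T i) \<and> card (T i) \<le> 40 * m * d \<and>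
      (\<forall>y\<in>T i. \<xi> i y \<in> nbrs y \<inter> L i)"
    by (rule exists_linked_targets[OF sub(1,2)]) (fact L_subset L(2) degL)+
  then obtain T \<xi> where targets: "\<forall>i\<in>I. T i \<subseteq> Y \<and> 10 * real m * d / s \<le> card (T i) \<and> card (T i) \<le> 40 * m * d \<and>
      (\<forall>y\<in>T i. \<xi> i y \<in> nbrs y \<inter> L i)"
    by (elim exE) (rule that)
  have T: "T i \<subseteq> Y" "10 * real m * d / s \<le> card (T i)" "card (T i) \<le> 40 * m * d" if "i \<in> I" for i
    using bspec[OF targets that] by simp_all
  have link: "\<xi> i y \<in> nbrs y \<inter> L i" if "i \<in> I" "y \<in> T i" for i y
    using bspec[OF targets that(1)] that(2) by simp
  have link_mem: "\<xi> i y \<in> X" if "i \<in> I" "y \<in> T i" for i y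
    using link[OF that] L_subset[OF that(1)] by auto
  have "0 < 10 * real m * d / s"
    using m_pos degree_pos two_le_s by simp
  then have T_nonempty: "T i \<noteq> {}" if "i \<in> I" for i
    using T(2)[OF that] by auto
  have "set_grouping X I T (\<lambda>y. nbrs y \<inter> X) \<xi> (1 / (40 * real m)) (real d)"
    by (rule set_grouping_targets[OF sub disj(5) T(1) T_nonempty T(3) link_mem degY])
  from set_grouping.exists_grouping[OF this] obtain C g H
    where C: "C \<subseteq> X" "real (card C) \<le> 4 * (1 / (40 * real m)) * card X"
      and H: "H \<subseteq> \<Union> (T ` I)" "\<And>y. y \<in> H \<Longrightarrow> g y \<in> nbrs y \<inter> X \<inter> C"
      and many: "real (\<Sum>i\<in>I. card (T i)) / 2 \<le> (\<Sum>i\<in>I. card (g ` {y \<in> T i \<inter> H. \<xi> i y \<notin> C}))"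
    by blast
  have H_subset: "H \<subseteq> Y"
    using H(1) T(1) by blast
  have degree: "real m * d / (16 * s) * card (I \<union> C)
      \<le> (\<Sum>i\<in>I. card (g ` {y \<in> T i \<inter> H. \<xi> i y \<notin> C}))"
    using degree_of_grouping_le[OF cardX C(2) T(2)] many by (rule order_trans)
  show ?thesis
  proof (rule minor_of_grouping[OF sub(1,3) C(1) disj(1) _ _ disj(4,5) L(1) _ link degree])
    show "H \<inter> X = {}" "H \<inter> I = {}"
      using H_subset disj(2,3) by auto
    show "g y \<in> nbrs y \<inter> C" if "y \<in> H" for y
      using H(2)[OF that] by simp
  qed
qed

lemma card_nbrs_Diff_ge:
  assumes "2 * d \<le> card (nbrs x \<inter> Y)" "card (nbrs x \<inter> Z) < d" "Y \<subseteq> pverts G"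
  shows "d \<le> card (nbrs x \<inter> (Y - Z))"
proof -
  have "card (nbrs x \<inter> Y) \<le> card (nbrs x \<inter> (Y - Z) \<union> nbrs x \<inter> Z)"
    using in_arcsD2 pair_finite_verts by (intro card_mono) (auto intro: finite_subset[of _ "pverts G"])
  also have "\<dots> \<le> card (nbrs x \<inter> (Y - Z)) + card (nbrs x \<inter> Z)"
    by (rule card_Un_le)
  finally show ?thesis
    using assms by linarith
qed

lemma card_uncovered_le:
  assumes sub: "X \<subseteq> pverts G" "Y \<subseteq> pverts G" "card Y \<le> card X" "Z \<subseteq> Y"
    and degX: "\<And>x. x \<in> X \<Longrightarrow> 2 * d \<le> card (nbrs x \<inter> Y)"
    and maximal: "\<And>y. y \<in> Y - Z \<Longrightarrow> card (nbrs y \<inter> X - W) < 40 * m"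
  shows "8 * card (X - W - {x \<in> X. d \<le> card (nbrs x \<inter> Z)}) \<le> card X"
proof -
  define U where "U = X - W - {x \<in> X. d \<le> card (nbrs x \<inter> Z)}"
  have fin: "finite X" "finite Y"
    using sub by (simp_all add: finite_verts_subset)
  have "d * card U \<le> (40 * m) * card (Y - Z)"
  proof (rule mult_card_le_of_degrees[where R="parcs G"], unfold converse_parcs)
    fix x assume "x \<in> U"
    then have "x \<in> X" "card (nbrs x \<inter> Z) < d"
      by (auto simp: U_def)
    then show "d \<le> card (nbrs x \<inter> (Y - Z))"
      by (intro card_nbrs_Diff_ge degX sub(2))
  next
    fix y assume y: "y \<in> Y - Z"
    have "card (nbrs y \<inter> U) \<le> card (nbrs y \<inter> X - W)"
      using fin by (intro card_mono) (auto simp: U_def)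
    then show "card (nbrs y \<inter> U) \<le> 40 * m"
      using maximal[OF y] by simp
  qed (use fin in \<open>auto simp: U_def\<close>)
  also have "\<dots> \<le> (40 * m) * card X"
    using card_mono[OF fin(2), of "Y - Z"] sub(3) by (intro mult_le_mono2) auto
  finally have "d * card U \<le> (40 * m) * card X" .
  moreover have "320 * m \<le> d"
  proof -
    have "320 * m * 1 \<le> 2560 * m * s"
      using two_le_s by (intro mult_le_mono) auto
    then show ?thesis
      using degree_ge by linarith
  qed
  then have "320 * m * card U \<le> d * card U"
    by (rule mult_le_mono1)
  ultimately have "(40 * m) * (8 * card U) \<le> (40 * m) * card X"
    by linarith
  then have "8 * card U \<le> card X"
    using m_pos by simp
  then show ?thesis
    by (simp only: U_def)
qed

lemma card_le_of_maximal_packing: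
  assumes sub: "X \<subseteq> pverts G" "Y \<subseteq> pverts G" "card Y \<le> card X"
    and degX: "\<And>x. x \<in> X \<Longrightarrow> 2 * d \<le> card (nbrs x \<inter> Y)"
    and packing: "Z \<subseteq> Y" "star_packing (\<lambda>y. nbrs y \<inter> X) (40 * m) Z S"
    and maximal: "\<And>y. y \<in> Y - Z \<Longrightarrow> card (nbrs y \<inter> X - \<Union> (S ` Z)) < 40 * m"
    and few: "card {x \<in> X. d \<le> card (nbrs x \<inter> Z)} \<le> 5 * m * card Z"
  shows "card X \<le> 80 * m * card Z"
proof -
  define F where "F = {x \<in> X. d \<le> card (nbrs x \<inter> Z)}"
  define W where "W = \<Union> (S ` Z)"
  have "finite Z"
    using packing(1) sub(2) by (intro finite_verts_subset) simp
  then have "card W \<le> 40 * m * card Z"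
    unfolding W_def by (rule star_packing_card_leaves_le[OF packing(2)])
  moreover have "8 * card (X - W - F) \<le> card X"
    unfolding F_def W_def by (rule card_uncovered_le[OF sub packing(1) degX maximal])
  moreover have "W \<subseteq> X"
    using packing(2) by (auto simp: W_def star_packing_def)
  then have "card X = card (W \<union> F \<union> (X - W - F))"
    by (intro arg_cong[of _ _ card]) (auto simp: F_def)
  then have "card X \<le> card W + card F + card (X - W - F)"
    using card_Un_le[of "W \<union> F" "X - W - F"] card_Un_le[of W F] by linarith
  ultimately show ?thesis
    using few unfolding F_def by linarith
qed

lemma card_surviving_centres_ge:
  assumes S: "star_packing N (40 * m) Z S" "finite Z" "\<And>z. z \<in> Z \<Longrightarrow> finite (N z)"
    and F: "finite F" "card F \<le> 5 * m * card Z"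
  shows "3 * card Z \<le> 4 * card {z \<in> Z. 20 * m \<le> card (S z - F)}"
proof -
  let ?lost = "{z \<in> Z. card (S z - F) < 20 * m}"
  have "star_packing N (2 * (20 * m)) Z S"
    using S(1) by simp
  then have "20 * m * card ?lost \<le> card F"
    using S(2) F(1) S(3) by (rule card_stars_losing_half_le)
  then have "5 * m * (4 * card ?lost) \<le> 5 * m * card Z"
    using F(2) by linarith
  then have "4 * card ?lost \<le> card Z"
    using m_pos by simp
  moreover have "card Z = card ({z \<in> Z. 20 * m \<le> card (S z - F)} \<union> ?lost)"
    by (intro arg_cong[of _ _ card]) auto
  then have "card Z \<le> card {z \<in> Z. 20 * m \<le> card (S z - F)} + card ?lost"
    using card_Un_le[of "{z \<in> Z. 20 * m \<le> card (S z - F)}" ?lost] by linarith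
  ultimately show ?thesis
    by linarith
qed

lemma minor_of_spread_packing:
  assumes sub: "X \<subseteq> pverts G" "Y \<subseteq> pverts G" "X \<inter> Y = {}" "X \<noteq> {}"
    and degX: "\<And>x. x \<in> X \<Longrightarrow> 2 * d \<le> card (nbrs x \<inter> Y)"
    and degY: "\<And>y. y \<in> Y \<Longrightarrow> 2 * d \<le> card (nbrs y \<inter> X)"
    and packing: "Z \<subseteq> Y" "star_packing (\<lambda>y. nbrs y \<inter> X) (40 * m) Z S"
    and F: "F = {x \<in> X. d \<le> card (nbrs x \<inter> Z)}" "card F \<le> 5 * m * card Z"
    and cardX: "card X \<le> 80 * m * card Z"
  shows "has_minor_of_degree G (real m * d / (16 * s))"
proof -
  define I where "I = {z \<in> Z. 20 * m \<le> card (S z - F)}"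
  have fin: "finite X" "finite Z" "finite F"
    using sub(1,2) packing(1) F(1) by (auto intro: finite_verts_subset)
  have cardI: "3 * card Z \<le> 4 * card I"
    unfolding I_def
    by (rule card_surviving_centres_ge[OF packing(2) fin(2) _ fin(3) F(2)]) (use fin(1) in simp)
  have I_subset: "I \<subseteq> Z"
    by (auto simp: I_def)
  have S: "S z \<subseteq> nbrs z \<inter> X" "card (S z) = 40 * m" if "z \<in> I" for z
    using packing(2) I_subset that by (auto simp: star_packing_def)
  show ?thesis
  proof (rule minor_of_many_stars[of X "Y - Z" I "\<lambda>z. S z - F"])
    show "I \<noteq> {}"
      using cardX cardI sub(4) fin(1) by auto
    have "disjoint_family_on S I"
      using packing(2) I_subset by (auto simp: star_packing_def intro: disjoint_family_on_mono)
    then show "disjoint_family_on (\<lambda>z. S z - F) I"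
      by (auto simp: disjoint_family_on_def)
    show "S z - F \<subseteq> nbrs z \<inter> X" if "z \<in> I" for z
      using S(1)[OF that] by auto
    show "20 * m \<le> card (S z - F) \<and> card (S z - F) \<le> 40 * m" if "z \<in> I" for z
      using that S[OF that] card_mono[of "S z" "S z - F"] fin(1)
      by (auto simp: I_def intro: finite_subset)
    show "d \<le> card (nbrs x \<inter> (Y - Z))" if "z \<in> I" "x \<in> S z - F" for z x
    proof -
      have "x \<in> X" "card (nbrs x \<inter> Z) < d"
        using S(1)[OF that(1)] that(2) by (auto simp: F(1))
      then show ?thesis
        using degX sub(2) by (intro card_nbrs_Diff_ge) auto
    qed
    show "d \<le> card (nbrs y \<inter> X)" if "y \<in> Y - Z" for y
      using degY[of y] that by simp
    have "m * (3 * card Z) \<le> m * (4 * card I)"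
      using cardI by (rule mult_le_mono2)
    then show "card X \<le> 120 * m * card I"
      using cardX by linarith
  qed (use sub packing(1) I_subset in auto)
qed

lemma minor_of_bipartite:
  assumes sub: "X \<subseteq> pverts G" "Y \<subseteq> pverts G" "X \<inter> Y = {}" "X \<noteq> {}" "card Y \<le> card X"
    and degX: "\<And>x. x \<in> X \<Longrightarrow> 2 * d \<le> card (nbrs x \<inter> Y)"
    and degY: "\<And>y. y \<in> Y \<Longrightarrow> 2 * d \<le> card (nbrs y \<inter> X)"
  shows "has_minor_of_degree G (real m * d / (16 * s))"
proof -
  have fin: "finite X" "finite Y"
    using sub by (simp_all add: finite_verts_subset)
  obtain Z S where Z: "Z \<subseteq> Y" and packing: "star_packing (\<lambda>y. nbrs y \<inter> X) (40 * m) Z S"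
    and maximal: "\<And>y. y \<in> Y - Z \<Longrightarrow> card (nbrs y \<inter> X - \<Union> (S ` Z)) < 40 * m"
    using exists_maximal_star_packing[OF fin(2), of "\<lambda>y. nbrs y \<inter> X" "40 * m"] fin(1) by blast
  define F where "F = {x \<in> X. d \<le> card (nbrs x \<inter> Z)}"
  show ?thesis
  proof (cases "Z \<noteq> {} \<and> 5 * m * card Z \<le> card F")
    case True
    then show ?thesis
      using Z sub by (intro minor_of_few_centres[of F Z]) (auto simp: F_def)
  next
    case False
    have few: "card F \<le> 5 * m * card Z"
    proof (cases "Z = {}")
      case True
      then show ?thesis
        using degree_pos by (simp add: F_def)
    qed (use False in simp)
    then have cardX: "card X \<le> 80 * m * card Z"
      using sub(1,2,5) degX Z packing maximal unfolding F_def by (intro card_le_of_maximal_packing)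
    show ?thesis
      by (rule minor_of_spread_packing[OF sub(1-4) degX degY Z packing F_def few cardX])
  qed
qed

lemma minor_of_dense:
  assumes "pverts G \<noteq> {}" and dense: "16 * d * card (pverts G) \<le> card (parcs G)"
  shows "has_minor_of_degree G (real m * d / (16 * s))"
proof -
  have arcs: "parcs G \<subseteq> pverts G \<times> pverts G" "sym (parcs G)"
    by (auto intro!: symI dest: in_arcsD1 in_arcsD2 arcs_symmetric)
  have irrefl: "irrefl (parcs G)"
    using pair_no_loops by (force simp: irrefl_def)
  have "8 * d * card (pverts G) < 16 * d * card (pverts G)"
    using assms(1) degree_pos pair_finite_verts by (simp add: card_gt_0_iff)
  also note dense
  finally have "real (8 * d * card (pverts G)) < real (card (parcs G))"
    by (simp only: of_nat_less_iff)
  then have dense': "4 * real (2 * d) * card (pverts G) < card (parcs G)"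
    by simp
  obtain X Y where XY: "X \<subseteq> pverts G" "Y \<subseteq> pverts G" "X \<inter> Y = {}" "X \<noteq> {}" "Y \<noteq> {}"
    and degrees: "\<forall>x\<in>X. real (2 * d) \<le> card (nbrs x \<inter> Y)" "\<forall>y\<in>Y. real (2 * d) \<le> card (nbrs y \<inter> X)"
    using exists_bipartite_subgraph_min_degree[OF pair_finite_verts arcs irrefl of_nat_0_le_iff dense'] by blast
  have degX: "2 * d \<le> card (nbrs x \<inter> Y)" if "x \<in> X" for x
    using bspec[OF degrees(1) that] by (simp only: of_nat_le_iff)
  have degY: "2 * d \<le> card (nbrs y \<inter> X)" if "y \<in> Y" for y
    using bspec[OF degrees(2) that] by (simp only: of_nat_le_iff)
  show ?thesis
  proof (cases "card Y \<le> card X")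
    case True
    then show ?thesis
      using minor_of_bipartite[OF XY(1-4) True] degX degY by blast
  next
    case False
    moreover have "Y \<inter> X = {}"
      using XY(3) by auto
    ultimately show ?thesis
      using minor_of_bipartite[OF XY(2,1) _ XY(5) _ degY degX] by simp
  qed
qed

end

subsection \<open>Large average degree\<close>

lemma exists_root_scale:
  fixes K d s :: nat and \<alpha> :: real
  assumes s: "2 \<le> s" and K: "0 < K" "K \<le> d" and \<alpha>: "\<alpha> = 1 / (2 * (real s - 1))"
  shows "\<exists>m>0. K * m ^ (2 * (s - 1)) \<le> d \<and> (d / K) powr \<alpha> / 2 \<le> m"
proof -
  define x where "x = real d / K"
  define m where "m = nat \<lfloor>x powr \<alpha>\<rfloor>"
  have x_ge_1: "1 \<le> x"
    using K by (simp add: x_def)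
  moreover have "0 \<le> \<alpha>"
    using s \<alpha> by simp
  ultimately have powr_ge_1: "1 \<le> x powr \<alpha>"
    by (rule ge_one_powr_ge_zero)
  then have floor: "real m \<le> x powr \<alpha>" "x powr \<alpha> < m + 1"
    unfolding m_def by linarith+
  have "1 \<le> \<lfloor>x powr \<alpha>\<rfloor>"
    using powr_ge_1 by simp
  then have m_pos: "0 < m"
    by (simp add: m_def)
  have "real m ^ (2 * (s - 1)) \<le> (x powr \<alpha>) ^ (2 * (s - 1))"
    using floor(1) by (intro power_mono) auto
  also have "\<dots> = x powr (\<alpha> * (2 * (s - 1)))"
    using x_ge_1 by (simp add: powr_powr flip: powr_realpow)
  also have "\<alpha> * (2 * (s - 1)) = 1"
    using s \<alpha> by simp
  finally have "real m ^ (2 * (s - 1)) \<le> x"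
    using x_ge_1 by simp
  then have "real (K * m ^ (2 * (s - 1))) \<le> real d"
    using K by (simp add: x_def field_simps)
  then have "K * m ^ (2 * (s - 1)) \<le> d"
    by (simp only: of_nat_le_iff)
  moreover have "x powr \<alpha> / 2 \<le> m"
    using floor(2) m_pos by linarith
  ultimately show ?thesis
    using m_pos by (auto simp: x_def)
qed

lemma powr_add_one_le_product:
  fixes r d m K \<alpha> :: real
  assumes "0 \<le> r" "0 \<le> \<alpha>" "0 < K" and d: "r / 32 \<le> d" and m: "(d / K) powr \<alpha> / 2 \<le> m"
  shows "r powr (1 + \<alpha>) / (64 * (32 * K) powr \<alpha>) \<le> m * d"
proof -
  have "r powr \<alpha> / (32 * K) powr \<alpha> = (r / (32 * K)) powr \<alpha>"
    using assms by (simp add: powr_divide)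
  also have "\<dots> \<le> (d / K) powr \<alpha>"
    using assms by (intro powr_mono2) (auto simp: field_simps)
  also have "\<dots> \<le> 2 * m"
    using m by simp
  finally have "r powr \<alpha> / (32 * K) powr \<alpha> / 2 \<le> m"
    by simp
  then have "(r powr \<alpha> / (32 * K) powr \<alpha> / 2) * (r / 32) \<le> m * d"
    using assms by (intro mult_mono) (auto intro: order_trans[rotated])
  then show ?thesis
    unfolding powr_mult_base[OF assms(1), symmetric] by (simp add: mult_ac)
qed

definition minor_constant :: "nat \<Rightarrow> nat \<Rightarrow> real" where
  "minor_constant s k = 1 / (1024 * s * (32 * real (degree_threshold s k)) powr (1 / (2 * (real s - 1))))"

context bounded_codegree_graph
begin

lemma degree_threshold_pos: "0 < degree_threshold s k"
  using two_le_s k_pos by (simp add: degree_threshold_def)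

lemma minor_constant_mult_le:
  assumes "0 \<le> r" "r \<le> 32 * real (degree_threshold s k)"
  shows "minor_constant s k * r powr (1 + 1 / (2 * (real s - 1))) \<le> r"
proof -
  define \<alpha> where "\<alpha> = 1 / (2 * (real s - 1))"
  have \<alpha>: "0 \<le> \<alpha>"
    using two_le_s by (simp add: \<alpha>_def)
  have "r powr \<alpha> \<le> 1 * (32 * real (degree_threshold s k)) powr \<alpha>"
    unfolding mult_1 using assms \<alpha> by (intro powr_mono2) auto
  also have "\<dots> \<le> 1024 * s * (32 * real (degree_threshold s k)) powr \<alpha>"
    using two_le_s by (intro mult_right_mono) auto
  finally have "minor_constant s k * r powr \<alpha> \<le> 1"
    using two_le_s degree_threshold_pos
    unfolding minor_constant_def \<alpha>_def[symmetric] by (simp add: divide_le_eq)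
  then have "r * (minor_constant s k * r powr \<alpha>) \<le> r * 1"
    using assms(1) by (rule mult_left_mono)
  then show ?thesis
    unfolding \<alpha>_def[symmetric] powr_mult_base[OF assms(1), symmetric] by (simp add: mult_ac)
qed

lemma minor_of_large_average_degree:
  assumes nonempty: "pverts G \<noteq> {}" and large: "16 * real (degree_threshold s k) \<le> average_degree G"
  shows "has_minor_of_degree G (minor_constant s k * average_degree G powr (1 + 1 / (2 * (real s - 1))))"
proof -
  define K where "K = degree_threshold s k"
  define \<alpha> where "\<alpha> = 1 / (2 * (real s - 1))"
  define r where "r = average_degree G"
  define d where "d = nat \<lfloor>r / 16\<rfloor>"
  have K_pos: "0 < K"
    unfolding K_def by (rule degree_threshold_pos)
  have K_le_r: "16 * real K \<le> r"
    using large by (simp add: K_def r_def)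
  have floor: "real d \<le> r / 16" "r / 16 < real d + 1"
    using K_le_r by (auto simp: d_def) linarith+
  have K_le_d: "K \<le> d"
    using floor(2) K_le_r by linarith
  obtain m where m: "0 < m" "K * m ^ (2 * (s - 1)) \<le> d" "(d / K) powr \<alpha> / 2 \<le> m"
    using exists_root_scale[OF two_le_s K_pos K_le_d \<alpha>_def] by blast
  interpret contraction_scale G s k m d
    using m(1,2) by unfold_locales (simp_all add: K_def)
  have "16 * real d * card (pverts G) \<le> r * card (pverts G)"
    using floor(1) by (intro mult_right_mono) auto
  also have "\<dots> = card (parcs G)"
    using nonempty pair_finite_verts by (simp add: r_def average_degree_eq[OF pair_graph_axioms])
  finally have "real (16 * d * card (pverts G)) \<le> real (card (parcs G))"
    by simp
  then have "16 * d * card (pverts G) \<le> card (parcs G)"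
    by (simp only: of_nat_le_iff)
  then have minor: "has_minor_of_degree G (real m * d / (16 * s))"
    by (rule minor_of_dense[OF nonempty])
  have "r powr (1 + \<alpha>) / (64 * (32 * real K) powr \<alpha>) \<le> real m * d"
  proof (rule powr_add_one_le_product[OF _ _ _ _ m(3)])
    show "r / 32 \<le> d"
      using floor(2) K_le_d K_pos by linarith
  qed (use K_le_r K_pos two_le_s in \<open>auto simp: \<alpha>_def\<close>)
  then have "r powr (1 + \<alpha>) / (64 * (32 * real K) powr \<alpha>) / (16 * s) \<le> real m * d / (16 * s)"
    by (intro divide_right_mono) auto
  then have "minor_constant s k * r powr (1 + \<alpha>) \<le> real m * d / (16 * s)"
    unfolding minor_constant_def K_def \<alpha>_def[symmetric] by (simp add: mult_ac)
  with minor show ?thesis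
    unfolding r_def \<alpha>_def by (rule has_minor_of_degree_mono)
qed

lemma minor_of_average_degree:
  assumes "pverts G \<noteq> {}"
  shows "has_minor_of_degree G (minor_constant s k * average_degree G powr (1 + 1 / (2 * (real s - 1))))"
proof (cases "16 * real (degree_threshold s k) \<le> average_degree G")
  case True
  with assms show ?thesis
    by (rule minor_of_large_average_degree)
next
  case False
  then have "minor_constant s k * average_degree G powr (1 + 1 / (2 * (real s - 1))) \<le> average_degree G"
    by (intro minor_constant_mult_le) (auto simp: average_degree_def)
  with has_minor_of_degree_self[OF assms] show ?thesis
    by (rule has_minor_of_degree_mono)
qed

end

lemma bounded_codegree_graph_of_complete_bipartite_free:
  assumes "pair_graph G" "complete_bipartite_free s s' G" "2 \<le> s" "s \<le> s'"
  shows "bounded_codegree_graph G s s'"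
proof -
  interpret pair_graph G by fact
  have "card {y \<in> pverts G. A \<subseteq> parcs G `` {y}} \<le> s'" if A: "A \<subseteq> pverts G" "card A = s" for A
  proof (rule ccontr)
    assume "\<not> ?thesis"
    then obtain C where C: "C \<subseteq> {y \<in> pverts G. A \<subseteq> parcs G `` {y}}" "card C = s'"
      by (meson nat_le_linear obtain_subset_with_card_n)
    define H where "H = \<lparr>pverts = A \<union> C, parcs = A \<times> C \<union> C \<times> A\<rparr>"
    have "finite A" "finite C"
      using A C(1) pair_finite_verts by (auto intro: finite_subset)
    moreover have "A \<inter> C = {}"
      using C(1) pair_no_loops by fastforce
    ultimately have bipartite: "complete_bipartite_digraph s s' (with_proj H)"
      unfolding complete_bipartite_digraph_pair_def using A C
      by (intro conjI exI[of _ A] exI[of _ C]) (auto simp: H_def)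
    have "(c, a) \<in> parcs G" "(a, c) \<in> parcs G" if "a \<in> A" "c \<in> C" for a c
      using C(1) that arcs_symmetric[of c a] by auto
    moreover have "wf_digraph (with_proj H)"
      by unfold_locales (auto simp: H_def)
    ultimately have "subgraph (with_proj H) (with_proj G)"
      unfolding subgraph_def compatible_def using A C(1) wf_digraph by (auto simp: H_def)
    then show False
      using bipartite assms(2) unfolding complete_bipartite_free_def by blast
  qed
  then show ?thesis
    using assms by unfold_locales (auto simp: codegree_bounded_def)
qed

theorem theorem4p5:
  fixes s s' :: nat
  assumes "2 \<le> s" and "s \<le> s'"
  shows "\<exists>c :: real. c > 0 \<and>
    (\<forall>G :: 'a pair_pre_digraph.
       pair_graph G \<and> pverts G \<noteq> {} \<and> complete_bipartite_free s s' G \<longrightarrow>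
       (\<exists>\<Gamma> :: 'a pair_pre_digraph.
          pair_graph \<Gamma> \<and> pverts \<Gamma> \<noteq> {} \<and> is_minor \<Gamma> G \<and>
          average_degree \<Gamma> \<ge> c * average_degree G powr (1 + 1 / (2 * (real s - 1)))))"
proof (intro exI[of _ "minor_constant s s'"] conjI allI impI; (elim conjE)?)
  show "0 < minor_constant s s'"
    using assms by (simp add: minor_constant_def degree_threshold_def)
  fix G :: "'a pair_pre_digraph"
  assume G: "pair_graph G" "pverts G \<noteq> {}" "complete_bipartite_free s s' G"
  then interpret bounded_codegree_graph G s s'
    using assms by (intro bounded_codegree_graph_of_complete_bipartite_free)
  show "\<exists>\<Gamma> :: 'a pair_pre_digraph.
      pair_graph \<Gamma> \<and> pverts \<Gamma> \<noteq> {} \<and> is_minor \<Gamma> G \<and>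
      minor_constant s s' * average_degree G powr (1 + 1 / (2 * (real s - 1))) \<le> average_degree \<Gamma>"
    using minor_of_average_degree[OF G(2)] unfolding has_minor_of_degree_def .
qed

end
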